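(* Given any finite constant specification $\mathsf{CS}$ for $\mathsf{JT}$, and any sequent $\Gamma\Rightarrow\Delta$ in the language of $\mathsf{G3JT}$, it is decidable whether the sequent is derivable in $\mathsf{G3JT}_{\mathsf{CS}}$.
   Context: Logic $\mathsf{JT}$. Terms are built from justification variables and constants by binary $\cdot,+$. Formulas are built from propositional variables and $\bot$ by $\neg,\wedge,\vee,\to$ and $t:A$ ($t$ a term). Axiom schemes: propositional tautologies; $s:A\to(s+t):A$, $s:A\to(t+s):A$; $s:(A\to B)\to(t:A\to(s\cdot t):B)$; $t:A\to A$. A constant specification $\mathsf{CS}$ for $\mathsf{JT}$ is a set of formulas $c_n:\dots:c_1:A$ ($n\ge1$, $c_j$ constants, $A$ an axiom instance), closed under passing from $c_n:c_{n-1}:\dots:c_1:A$ to $c_{n-1}:\dots:c_1:A$. Calculus $\mathsf{G3JT}_{\mathsf{CS}}$. Fix a countably infinite set of labels $w,v,u,\dots$. The labeled language has labeled formulas $w\Vvdash A$, relational atoms $wRv$ and evidence atoms $wE(t,A)$ ($A$ a formula, $t$ a term). Sequents $\Gamma\Rightarrow\Delta$ consist of finite multisets of these. Initial sequents: $w\Vvdash P,\Gamma\Rightarrow\Delta,w\Vvdash P$ ($P$ a propositional variable); $w\Vvdash\bot,\Gamma\Rightarrow\Delta$; $wRv,\Gamma\Rightarrow\Delta,wRv$; $wE(t,A),\Gamma\Rightarrow\Delta,wE(t,A)$. Rules (premises / conclusion): (L$\neg$) $\Gamma\Rightarrow\Delta,w\Vvdash A$ / $w\Vvdash\neg A,\Gamma\Rightarrow\Delta$;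 (R$\neg$) $w\Vvdash A,\Gamma\Rightarrow\Delta$ / $\Gamma\Rightarrow\Delta,w\Vvdash\neg A$; (L$\wedge$) $w\Vvdash A,w\Vvdash B,\Gamma\Rightarrow\Delta$ / $w\Vvdash A\wedge B,\Gamma\Rightarrow\Delta$; (R$\wedge$) $\Gamma\Rightarrow\Delta,w\Vvdash A$ and $\Gamma\Rightarrow\Delta,w\Vvdash B$ / $\Gamma\Rightarrow\Delta,w\Vvdash A\wedge B$; (L$\vee$) $w\Vvdash A,\Gamma\Rightarrow\Delta$ and $w\Vvdash B,\Gamma\Rightarrow\Delta$ / $w\Vvdash A\vee B,\Gamma\Rightarrow\Delta$; (R$\vee$) $\Gamma\Rightarrow\Delta,w\Vvdash A,w\Vvdash B$ / $\Gamma\Rightarrow\Delta,w\Vvdash A\vee B$; (L$\to$) $\Gamma\Rightarrow\Delta,w\Vvdash A$ and $w\Vvdash B,\Gamma\Rightarrow\Delta$ / $w\Vvdash A\to B,\Gamma\Rightarrow\Delta$; (R$\to$) $w\Vvdash A,\Gamma\Rightarrow\Delta,w\Vvdash B$ / $\Gamma\Rightarrow\Delta,w\Vvdash A\to B$; (L:) $v\Vvdash A,w\Vvdash t:A,wRv,\Gamma\Rightarrow\Delta$ / $w\Vvdash t:A,wRv,\Gamma\Rightarrow\Delta$; (R:) $wRv,wE(t,A),\Gamma\Rightarrow\Delta,v\Vvdash A$ / $wE(t,A),\Gamma\Rightarrow\Delta,w\Vvdash t:A$, where $v$ does not occur in the conclusion; (E) $wE(t,A),w\Vvdash t:A,\Gamma\Rightarrow\Delta$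 / $w\Vvdash t:A,\Gamma\Rightarrow\Delta$; (El+) $wE(s+t,A),wE(t,A),\Gamma\Rightarrow\Delta$ / $wE(t,A),\Gamma\Rightarrow\Delta$; (Er+) $wE(t+s,A),wE(t,A),\Gamma\Rightarrow\Delta$ / $wE(t,A),\Gamma\Rightarrow\Delta$; (E$\cdot$) $wE(s\cdot t,B),wE(s,A\to B),wE(t,A),\Gamma\Rightarrow\Delta$ / $wE(s,A\to B),wE(t,A),\Gamma\Rightarrow\Delta$; (IAN) $wE(c,F),\Gamma\Rightarrow\Delta$ / $\Gamma\Rightarrow\Delta$, for $c:F\in\mathsf{CS}$ ($c$ a constant); (Ref) $wRw,\Gamma\Rightarrow\Delta$ / $\Gamma\Rightarrow\Delta$. *)

theory Defs
  imports Main "HOL-Library.Multiset" "HOL-Library.Nat_Bijection"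
begin

section \<open>Justification logic JT\<close>

datatype tm =
    JVar nat
  | JConst nat
  | App tm tm
  | Sum tm tm

datatype fm =
    PVar nat
  | Bot
  | Neg fm
  | And fm fm
  | Or fm fm
  | Imp fm fm
  | Just tm fm

text \<open>Propositional evaluation in which the propositional variables and the formulas
  \<open>Just t A\<close> are atomic, with truth values given by \<open>V\<close>. A formula true under every such \<open>V\<close> is
  precisely a substitution instance of a propositional tautology.\<close>

primrec prop_eval :: "(fm \<Rightarrow> bool) \<Rightarrow> fm \<Rightarrow> bool" where
  "prop_eval V (PVar p) = V (PVar p)"
| "prop_eval V Bot = False"
| "prop_eval V (Neg A) = (\<not> prop_eval V A)"
| "prop_eval V (And A B) = (prop_eval V A \<and> prop_eval V B)"
| "prop_eval V (Or A B) = (prop_eval V A \<or> prop_eval V B)"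
| "prop_eval V (Imp A B) = (prop_eval V A \<longrightarrow> prop_eval V B)"
| "prop_eval V (Just t A) = V (Just t A)"

inductive JT_axiom :: "fm \<Rightarrow> bool" where
  taut: "(\<And>V. prop_eval V A) \<Longrightarrow> JT_axiom A"
| sum_left: "JT_axiom (Imp (Just s A) (Just (Sum s t) A))"
| sum_right: "JT_axiom (Imp (Just s A) (Just (Sum t s) A))"
| app: "JT_axiom (Imp (Just s (Imp A B)) (Imp (Just t A) (Just (App s t) B)))"
| refl: "JT_axiom (Imp (Just t A) A)"

text \<open>\<open>consts_just [c\<^sub>n, \<dots>, c\<^sub>1] A\<close> is \<open>c\<^sub>n : \<dots> : c\<^sub>1 : A\<close>.\<close>

definition consts_just :: "nat list \<Rightarrow> fm \<Rightarrow> fm" where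
  "consts_just cs A = foldr (\<lambda>c B. Just (JConst c) B) cs A"

definition constant_specification :: "fm set \<Rightarrow> bool" where
  "constant_specification CS \<longleftrightarrow>
     (\<forall>F\<in>CS. \<exists>cs A. cs \<noteq> [] \<and> JT_axiom A \<and> F = consts_just cs A) \<and>
     (\<forall>c cs A. cs \<noteq> [] \<longrightarrow> JT_axiom A \<longrightarrow> consts_just (c # cs) A \<in> CS \<longrightarrow> consts_just cs A \<in> CS)"


section \<open>The labeled sequent calculus G3JT\<close>

type_synonym label = nat

datatype lfm =
    Forces label fm
  | Rel label label
  | Evid label tm fm

type_synonym sequent = "lfm multiset \<times> lfm multiset"

primrec labels :: "lfm \<Rightarrow> label set" where
  "labels (Forces w A) = {w}"
| "labels (Rel w v) = {w, v}"
| "labels (Evid w t A) = {w}"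

definition labels_mset :: "lfm multiset \<Rightarrow> label set" where
  "labels_mset \<Gamma> = (\<Union>\<phi>\<in>set_mset \<Gamma>. labels \<phi>)"

inductive G3JT :: "fm set \<Rightarrow> lfm multiset \<Rightarrow> lfm multiset \<Rightarrow> bool" for CS :: "fm set" where
  init_PVar: "G3JT CS (add_mset (Forces w (PVar p)) \<Gamma>) (add_mset (Forces w (PVar p)) \<Delta>)"
| init_Bot: "G3JT CS (add_mset (Forces w Bot) \<Gamma>) \<Delta>"
| init_Rel: "G3JT CS (add_mset (Rel w v) \<Gamma>) (add_mset (Rel w v) \<Delta>)"
| init_Evid: "G3JT CS (add_mset (Evid w t A) \<Gamma>) (add_mset (Evid w t A) \<Delta>)"
| L_Neg:
    "G3JT CS \<Gamma> (add_mset (Forces w A) \<Delta>) \<Longrightarrow>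
     G3JT CS (add_mset (Forces w (Neg A)) \<Gamma>) \<Delta>"
| R_Neg:
    "G3JT CS (add_mset (Forces w A) \<Gamma>) \<Delta> \<Longrightarrow>
     G3JT CS \<Gamma> (add_mset (Forces w (Neg A)) \<Delta>)"
| L_And:
    "G3JT CS (add_mset (Forces w A) (add_mset (Forces w B) \<Gamma>)) \<Delta> \<Longrightarrow>
     G3JT CS (add_mset (Forces w (And A B)) \<Gamma>) \<Delta>"
| R_And:
    "G3JT CS \<Gamma> (add_mset (Forces w A) \<Delta>) \<Longrightarrow>
     G3JT CS \<Gamma> (add_mset (Forces w B) \<Delta>) \<Longrightarrow>
     G3JT CS \<Gamma> (add_mset (Forces w (And A B)) \<Delta>)"
| L_Or:
    "G3JT CS (add_mset (Forces w A) \<Gamma>) \<Delta> \<Longrightarrow>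
     G3JT CS (add_mset (Forces w B) \<Gamma>) \<Delta> \<Longrightarrow>
     G3JT CS (add_mset (Forces w (Or A B)) \<Gamma>) \<Delta>"
| R_Or:
    "G3JT CS \<Gamma> (add_mset (Forces w A) (add_mset (Forces w B) \<Delta>)) \<Longrightarrow>
     G3JT CS \<Gamma> (add_mset (Forces w (Or A B)) \<Delta>)"
| L_Imp:
    "G3JT CS \<Gamma> (add_mset (Forces w A) \<Delta>) \<Longrightarrow>
     G3JT CS (add_mset (Forces w B) \<Gamma>) \<Delta> \<Longrightarrow>
     G3JT CS (add_mset (Forces w (Imp A B)) \<Gamma>) \<Delta>"
| R_Imp:
    "G3JT CS (add_mset (Forces w A) \<Gamma>) (add_mset (Forces w B) \<Delta>) \<Longrightarrow>
     G3JT CS \<Gamma> (add_mset (Forces w (Imp A B)) \<Delta>)"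
| L_Just:
    "G3JT CS (add_mset (Forces v A) (add_mset (Forces w (Just t A)) (add_mset (Rel w v) \<Gamma>))) \<Delta> \<Longrightarrow>
     G3JT CS (add_mset (Forces w (Just t A)) (add_mset (Rel w v) \<Gamma>)) \<Delta>"
| R_Just:
    "G3JT CS (add_mset (Rel w v) (add_mset (Evid w t A) \<Gamma>)) (add_mset (Forces v A) \<Delta>) \<Longrightarrow>
     v \<notin> labels_mset (add_mset (Evid w t A) \<Gamma>) \<Longrightarrow>
     v \<notin> labels_mset (add_mset (Forces w (Just t A)) \<Delta>) \<Longrightarrow>
     G3JT CS (add_mset (Evid w t A) \<Gamma>) (add_mset (Forces w (Just t A)) \<Delta>)"
| E:
    "G3JT CS (add_mset (Evid w t A) (add_mset (Forces w (Just t A)) \<Gamma>)) \<Delta> \<Longrightarrow>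
     G3JT CS (add_mset (Forces w (Just t A)) \<Gamma>) \<Delta>"
| El_Sum:
    "G3JT CS (add_mset (Evid w (Sum s t) A) (add_mset (Evid w t A) \<Gamma>)) \<Delta> \<Longrightarrow>
     G3JT CS (add_mset (Evid w t A) \<Gamma>) \<Delta>"
| Er_Sum:
    "G3JT CS (add_mset (Evid w (Sum t s) A) (add_mset (Evid w t A) \<Gamma>)) \<Delta> \<Longrightarrow>
     G3JT CS (add_mset (Evid w t A) \<Gamma>) \<Delta>"
| E_App:
    "G3JT CS (add_mset (Evid w (App s t) B)
       (add_mset (Evid w s (Imp A B)) (add_mset (Evid w t A) \<Gamma>))) \<Delta> \<Longrightarrow>
     G3JT CS (add_mset (Evid w s (Imp A B)) (add_mset (Evid w t A) \<Gamma>)) \<Delta>"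
| IAN:
    "G3JT CS (add_mset (Evid w (JConst c) F) \<Gamma>) \<Delta> \<Longrightarrow>
     Just (JConst c) F \<in> CS \<Longrightarrow>
     G3JT CS \<Gamma> \<Delta>"
| Ref:
    "G3JT CS (add_mset (Rel w w) \<Gamma>) \<Delta> \<Longrightarrow>
     G3JT CS \<Gamma> \<Delta>"


section \<open>General recursive functions and decidability\<close>

text \<open>\<open>recursive n f\<close>: the restriction of \<open>f\<close> to argument lists of length \<open>n\<close> is a general
  recursive function, obtained from the initial functions by composition, primitive recursion
  and minimization of regular functions. Values of \<open>f\<close> on lists of other lengths are
  irrelevant and unconstrained.\<close>

inductive recursive :: "nat \<Rightarrow> (nat list \<Rightarrow> nat) \<Rightarrow> bool" where
  zero: "recursive n (\<lambda>xs. 0)"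
| succ: "recursive 1 (\<lambda>xs. Suc (xs ! 0))"
| proj: "i < n \<Longrightarrow> recursive n (\<lambda>xs. xs ! i)"
| comp:
    "recursive (length gs) f \<Longrightarrow> (\<forall>g\<in>set gs. recursive n g) \<Longrightarrow>
     recursive n (\<lambda>xs. f (map (\<lambda>g. g xs) gs))"
| prim_rec:
    "recursive n f \<Longrightarrow> recursive (Suc (Suc n)) g \<Longrightarrow>
     recursive (Suc n) (\<lambda>xs. rec_nat (f (tl xs)) (\<lambda>k r. g (k # r # tl xs)) (hd xs))"
| minimization:
    "recursive (Suc n) f \<Longrightarrow> (\<forall>xs. length xs = n \<longrightarrow> (\<exists>y. f (y # xs) = 0)) \<Longrightarrow>
     recursive n (\<lambda>xs. LEAST y. f (y # xs) = 0)"

text \<open>The problem \<open>P\<close> with set of instances \<open>D\<close>, presented by the Goedel numbering \<open>code\<close>, is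
  decidable: one algorithm answers correctly on every instance.\<close>

definition decidable_on :: "('a \<Rightarrow> nat) \<Rightarrow> 'a set \<Rightarrow> ('a \<Rightarrow> bool) \<Rightarrow> bool" where
  "decidable_on code D P \<longleftrightarrow>
     (\<exists>f. recursive 1 f \<and> (\<forall>x\<in>D. f [code x] = (if P x then 1 else 0)))"


section \<open>Goedel numbering of the decision problem\<close>

primrec tm_code :: "tm \<Rightarrow> nat" where
  "tm_code (JVar n) = prod_encode (0, n)"
| "tm_code (JConst n) = prod_encode (1, n)"
| "tm_code (App s t) = prod_encode (2, prod_encode (tm_code s, tm_code t))"
| "tm_code (Sum s t) = prod_encode (3, prod_encode (tm_code s, tm_code t))"

primrec fm_code :: "fm \<Rightarrow> nat" where
  "fm_code (PVar n) = prod_encode (0, n)"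
| "fm_code Bot = prod_encode (1, 0)"
| "fm_code (Neg A) = prod_encode (2, fm_code A)"
| "fm_code (And A B) = prod_encode (3, prod_encode (fm_code A, fm_code B))"
| "fm_code (Or A B) = prod_encode (4, prod_encode (fm_code A, fm_code B))"
| "fm_code (Imp A B) = prod_encode (5, prod_encode (fm_code A, fm_code B))"
| "fm_code (Just t A) = prod_encode (6, prod_encode (tm_code t, fm_code A))"

primrec lfm_code :: "lfm \<Rightarrow> nat" where
  "lfm_code (Forces w A) = prod_encode (0, prod_encode (w, fm_code A))"
| "lfm_code (Rel w v) = prod_encode (1, prod_encode (w, v))"
| "lfm_code (Evid w t A) = prod_encode (2, prod_encode (w, prod_encode (tm_code t, fm_code A)))"

text \<open>Finite sets and multisets are presented by the increasing list of the codes of their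
  elements.\<close>

definition cs_code :: "fm set \<Rightarrow> nat" where
  "cs_code CS = list_encode (sorted_list_of_set (fm_code ` CS))"

definition mset_code :: "lfm multiset \<Rightarrow> nat" where
  "mset_code \<Gamma> = list_encode (sorted_list_of_multiset (image_mset lfm_code \<Gamma>))"

fun sequent_code :: "sequent \<Rightarrow> nat" where
  "sequent_code (\<Gamma>, \<Delta>) = prod_encode (mset_code \<Gamma>, mset_code \<Delta>)"

fun instance_code :: "fm set \<times> sequent \<Rightarrow> nat" where
  "instance_code (CS, S) = prod_encode (cs_code CS, sequent_code S)"

text \<open>The numbering is injective on the instances that are considered, so an instance is
  determined by its code.\<close>

lemma tm_code_inject: "tm_code s = tm_code t \<longleftrightarrow> s = t"
proof (induction s arbitrary: t)
  case (JVar x) then show ?case by (cases t) auto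
next
  case (JConst x) then show ?case by (cases t) auto
next
  case (App s1 s2) then show ?case by (cases t) auto
next
  case (Sum s1 s2) then show ?case by (cases t) auto
qed

lemma fm_code_inject: "fm_code A = fm_code B \<longleftrightarrow> A = B"
proof (induction A arbitrary: B)
  case (PVar x) then show ?case by (cases B) auto
next
  case Bot then show ?case by (cases B) auto
next
  case (Neg A) then show ?case by (cases B) auto
next
  case (And A1 A2) then show ?case by (cases B) auto
next
  case (Or A1 A2) then show ?case by (cases B) auto
next
  case (Imp A1 A2) then show ?case by (cases B) auto
next
  case (Just t A) then show ?case by (cases B) (auto simp: tm_code_inject)
qed

lemma lfm_code_inject: "lfm_code \<phi> = lfm_code \<psi> \<longleftrightarrow> \<phi> = \<psi>"
  by (cases \<phi>; cases \<psi>) (auto simp: tm_code_inject fm_code_inject)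

lemma cs_code_inject:
  assumes "finite CS" "finite CS'"
  shows "cs_code CS = cs_code CS' \<longleftrightarrow> CS = CS'"
proof
  assume "cs_code CS = cs_code CS'"
  then have "sorted_list_of_set (fm_code ` CS) = sorted_list_of_set (fm_code ` CS')"
    unfolding cs_code_def using inj_list_encode[of UNIV] by (auto dest: injD)
  then have "fm_code ` CS = fm_code ` CS'"
    using assms by (metis finite_imageI set_sorted_list_of_set)
  moreover have "inj fm_code"
    by (simp add: inj_def fm_code_inject)
  ultimately show "CS = CS'"
    by (simp add: inj_image_eq_iff)
qed simp

lemma mset_code_inject: "mset_code \<Gamma> = mset_code \<Delta> \<longleftrightarrow> \<Gamma> = \<Delta>"
proof
  assume "mset_code \<Gamma> = mset_code \<Delta>"
  then have "sorted_list_of_multiset (image_mset lfm_code \<Gamma>) =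
      sorted_list_of_multiset (image_mset lfm_code \<Delta>)"
    unfolding mset_code_def using inj_list_encode[of UNIV] by (auto dest: injD)
  then have "image_mset lfm_code \<Gamma> = image_mset lfm_code \<Delta>"
    by (metis mset_sorted_list_of_multiset)
  moreover have "inj lfm_code"
    by (simp add: inj_def lfm_code_inject)
  ultimately show "\<Gamma> = \<Delta>"
    by (metis multiset.inj_map injD)
qed simp

lemma inj_on_instance_code: "inj_on instance_code ({CS. finite CS} \<times> UNIV)"
  by (auto simp: inj_on_def cs_code_inject mset_code_inject)

end

theory Submission
  imports Defs
begin

text \<open>The rules of the calculus are sound for Fitting models. Conversely, read bottom-up, each rule
  replaces a formula by its components or adds an atom, so a fair infinite branch of underivable
  sequents yields a countermodel. Only the truth values of the subformulas and the finitely many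
  relevant evidence pairs matter at a world, hence a countermodel can be filtrated to a finite one
  whose worlds are sets of numbers bounded by the code \<open>x\<close> of the instance. Whether such a model
  exists is a statement about \<open>x\<close> in which all quantifiers are bounded by recursive functions of
  \<open>x\<close>. The evidence closure is infinite, but evidence for a term only depends on evidence for
  its subterms, so the filtrated model may admit all evidence for terms with codes above \<open>x\<close>.\<close>

section \<open>Recursive functions of one argument\<close>

text \<open>No bound on derivations can be read off the rules: upwards, \<open>El_Sum\<close>,
  \<open>Er_Sum\<close> and \<open>E_App\<close> create ever larger terms, while \<open>Ref\<close>
  and \<open>IAN\<close> apply at every label. The bound is therefore put on models. Since
  accessibility only has to be reflexive, filtration is easy except for relational atoms: one on the
  right of the sequent must fail, whereas filtration tends to add accessibility. Worlds therefore
  keep the label that they interpret, and successors needed to refute \<open>Just t A\<close> carry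
  the extra label \<open>Suc x\<close>, about which the sequent says nothing. The conditions on
  models quantify over all numbers up to \<open>x\<close>, not only over codes of syntax. So no
  recursive recognizer of terms and formulas is needed, at the price of specifying how non-codes
  behave. The specification is read from \<open>x\<close> as well, so one recursive function serves
  all finite specifications.\<close>

definition rec_fun :: "nat \<Rightarrow> (nat list \<Rightarrow> nat) \<Rightarrow> bool" where
  "rec_fun n f \<longleftrightarrow> (\<exists>g. recursive n g \<and> (\<forall>xs. length xs = n \<longrightarrow> g xs = f xs))"

lemma rec_funI: "recursive n f \<Longrightarrow> rec_fun n f"
  unfolding rec_fun_def by blast

text \<open>\<open>recursive\<close> fixes the values on lists of every length, so an equation valid
  only for lists of length \<open>n\<close> does not transfer to it. \<open>rec_fun\<close> absorbs
  the irrelevant values and makes this rule available.\<close>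

lemma rec_fun_cong:
  "rec_fun n f \<Longrightarrow> (\<And>xs. length xs = n \<Longrightarrow> f xs = g xs) \<Longrightarrow> rec_fun n g"
  unfolding rec_fun_def by auto

lemma rec_fun_comp:
  assumes "rec_fun (length gs) f" "\<And>g. g \<in> set gs \<Longrightarrow> rec_fun n g"
  shows "rec_fun n (\<lambda>xs. f (map (\<lambda>g. g xs) gs))"
proof -
  obtain f' where f': "recursive (length gs) f'" "\<And>xs. length xs = length gs \<Longrightarrow> f' xs = f xs"
    using assms(1) unfolding rec_fun_def by blast
  have "\<forall>g\<in>set gs. \<exists>g'. recursive n g' \<and> (\<forall>xs. length xs = n \<longrightarrow> g' xs = g xs)"
    using assms(2) unfolding rec_fun_def by blast
  then obtain F where F: "\<And>g. g \<in> set gs \<Longrightarrow> recursive n (F g)"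
    "\<And>g xs. g \<in> set gs \<Longrightarrow> length xs = n \<Longrightarrow> F g xs = g xs"
    by metis
  have "rec_fun n (\<lambda>xs. f' (map (\<lambda>g. g xs) (map F gs)))"
    by (rule rec_funI, rule recursive.comp) (simp_all add: f'(1) F(1))
  then show ?thesis
  proof (rule rec_fun_cong)
    fix xs :: "nat list"
    assume "length xs = n"
    then have "map (\<lambda>g. g xs) (map F gs) = map (\<lambda>g. g xs) gs"
      by (simp add: F(2))
    then show "f' (map (\<lambda>g. g xs) (map F gs)) = f (map (\<lambda>g. g xs) gs)"
      using f'(2)[of "map (\<lambda>g. g xs) gs"] by (simp only: length_map)
  qed
qed

lemma rec_fun_prim_rec:
  assumes "rec_fun n f" "rec_fun (Suc (Suc n)) g"
  shows "rec_fun (Suc n) (\<lambda>xs. rec_nat (f (tl xs)) (\<lambda>k r. g (k # r # tl xs)) (hd xs))"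
proof -
  obtain f' where f': "recursive n f'" "\<And>xs. length xs = n \<Longrightarrow> f' xs = f xs"
    using assms(1) unfolding rec_fun_def by blast
  obtain g' where g': "recursive (Suc (Suc n)) g'" "\<And>xs. length xs = Suc (Suc n) \<Longrightarrow> g' xs = g xs"
    using assms(2) unfolding rec_fun_def by blast
  have "rec_fun (Suc n) (\<lambda>xs. rec_nat (f' (tl xs)) (\<lambda>k r. g' (k # r # tl xs)) (hd xs))"
    by (rule rec_funI, rule recursive.prim_rec) (rule f'(1) g'(1))+
  then show ?thesis
  proof (rule rec_fun_cong)
    fix xs :: "nat list"
    assume "length xs = Suc n"
    then have "rec_nat (f' (tl xs)) (\<lambda>k r. g' (k # r # tl xs)) m
        = rec_nat (f (tl xs)) (\<lambda>k r. g (k # r # tl xs)) m" for m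
      by (induction m) (simp_all add: f'(2) g'(2))
    then show "rec_nat (f' (tl xs)) (\<lambda>k r. g' (k # r # tl xs)) (hd xs)
        = rec_nat (f (tl xs)) (\<lambda>k r. g (k # r # tl xs)) (hd xs)" .
  qed
qed

definition computable :: "(nat \<Rightarrow> nat) \<Rightarrow> bool" where
  "computable f \<longleftrightarrow> rec_fun 1 (\<lambda>xs. f (xs ! 0))"

definition computable2 :: "(nat \<Rightarrow> nat \<Rightarrow> nat) \<Rightarrow> bool" where
  "computable2 f \<longleftrightarrow> rec_fun 2 (\<lambda>xs. f (xs ! 0) (xs ! 1))"

lemma rec_fun_proj: "i < n \<Longrightarrow> rec_fun n (\<lambda>xs. xs ! i)"
  by (intro rec_funI recursive.proj)

lemma rec_fun_comp1: "computable h \<Longrightarrow> rec_fun n f \<Longrightarrow> rec_fun n (\<lambda>xs. h (f xs))"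
  using rec_fun_comp[of "[f]" "\<lambda>xs. h (xs ! 0)" n] by (simp add: computable_def)

lemma rec_fun_comp2:
  "computable2 h \<Longrightarrow> rec_fun n f \<Longrightarrow> rec_fun n g \<Longrightarrow> rec_fun n (\<lambda>xs. h (f xs) (g xs))"
  using rec_fun_comp[of "[f, g]" "\<lambda>xs. h (xs ! 0) (xs ! 1)" n]
  by (auto simp: computable2_def numeral_2_eq_2)

lemma computable_comp: "computable f \<Longrightarrow> computable g \<Longrightarrow> computable (\<lambda>x. f (g x))"
  using rec_fun_comp1[of f 1 "\<lambda>xs. g (xs ! 0)"] by (simp add: computable_def)

lemma computable_comp2:
  "computable2 h \<Longrightarrow> computable f \<Longrightarrow> computable g \<Longrightarrow> computable (\<lambda>x. h (f x) (g x))"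
  using rec_fun_comp2[of h 1 "\<lambda>xs. f (xs ! 0)" "\<lambda>xs. g (xs ! 0)"] by (simp add: computable_def)

lemma computable_id: "computable (\<lambda>x. x)"
  unfolding computable_def by (rule rec_fun_proj) simp

lemma computable_succ: "computable Suc"
  unfolding computable_def by (rule rec_funI[OF recursive.succ])

lemma rec_fun_const: "rec_fun n (\<lambda>xs. c)"
  by (induction c) (auto intro: rec_funI recursive.zero rec_fun_comp1[OF computable_succ])

lemma computable_const: "computable (\<lambda>x. c)"
  unfolding computable_def by (rule rec_fun_const)

text \<open>The recursion runs over the first argument because \<open>recursive.prim_rec\<close>
  recurses on the head of the list; the second argument is the parameter.\<close>

lemma computable2_rec:
  assumes "computable f" "rec_fun 3 (\<lambda>xs. g (xs ! 0) (xs ! 1) (xs ! 2))"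
  shows "computable2 (\<lambda>a b. rec_nat (f b) (\<lambda>k r. g k r b) a)"
proof -
  have "rec_fun 2 (\<lambda>xs. rec_nat (f (tl xs ! 0))
      (\<lambda>k r. g ((k # r # tl xs) ! 0) ((k # r # tl xs) ! 1) ((k # r # tl xs) ! 2)) (hd xs))"
    using rec_fun_prim_rec[of 1 "\<lambda>xs. f (xs ! 0)" "\<lambda>xs. g (xs ! 0) (xs ! 1) (xs ! 2)"] assms
    by (simp add: computable_def numeral_2_eq_2 numeral_3_eq_3)
  moreover have "rec_nat (f (tl xs ! 0))
      (\<lambda>k r. g ((k # r # tl xs) ! 0) ((k # r # tl xs) ! 1) ((k # r # tl xs) ! 2)) (hd xs)
      = rec_nat (f (xs ! 1)) (\<lambda>k r. g k r (xs ! 1)) (xs ! 0)" if "length xs = 2" for xs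
  proof -
    from that obtain a b where "xs = [a, b]"
      by (auto simp: numeral_2_eq_2 length_Suc_conv)
    then show ?thesis by simp
  qed
  ultimately show ?thesis
    unfolding computable2_def by (rule rec_fun_cong)
qed

lemma computable2_swap: "computable2 f \<Longrightarrow> computable2 (\<lambda>a b. f b a)"
  unfolding computable2_def[of "\<lambda>a b. f b a"] by (rule rec_fun_comp2[of f], auto intro: rec_fun_proj)

lemma computable2_add: "computable2 (+)"
proof -
  have "computable2 (\<lambda>a b. rec_nat b (\<lambda>k r. Suc r) a)"
    by (intro computable2_rec computable_id rec_fun_comp1[OF computable_succ] rec_fun_proj) simp
  moreover have "rec_nat b (\<lambda>k r. Suc r) a = a + b" for a b :: nat
    by (induction a) auto
  ultimately show ?thesis by simp
qed

lemma computable2_mult: "computable2 (*)"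
proof -
  have "computable2 (\<lambda>a b. rec_nat 0 (\<lambda>k r. r + b) a)"
    by (intro computable2_rec computable_const rec_fun_comp2[OF computable2_add] rec_fun_proj) auto
  moreover have "rec_nat 0 (\<lambda>k r. r + b) a = a * b" for a b :: nat
    by (induction a) auto
  ultimately show ?thesis by simp
qed

lemma computable_predecessor: "computable (\<lambda>x. x - 1)"
proof -
  have "computable2 (\<lambda>a b. rec_nat 0 (\<lambda>k r. k) a)"
    by (intro computable2_rec computable_const rec_fun_proj) auto
  moreover have "rec_nat 0 (\<lambda>k r. k) a = a - 1" for a :: nat
    by (cases a) auto
  ultimately have "computable2 (\<lambda>a b. a - 1)" by simp
  from computable_comp2[OF this computable_id computable_id] show ?thesis .
qed

lemma computable2_diff: "computable2 (-)"
proof -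
  have "computable2 (\<lambda>a b. rec_nat b (\<lambda>k r. r - 1) a)"
    by (intro computable2_rec computable_id rec_fun_comp1[OF computable_predecessor] rec_fun_proj) simp
  moreover have "rec_nat b (\<lambda>k r. r - 1) a = b - a" for a b :: nat
    by (induction a) auto
  ultimately have "computable2 (\<lambda>a b. b - a)" by simp
  from computable2_swap[OF this] show ?thesis by simp
qed

section \<open>Cantor pairing and its inverse\<close>

lemma computable_triangle: "computable triangle"
proof -
  have "computable2 (\<lambda>a b. rec_nat 0 (\<lambda>k r. r + Suc k) a)"
    by (intro computable2_rec computable_const rec_fun_comp2[OF computable2_add]
        rec_fun_comp1[OF computable_succ] rec_fun_proj) auto
  moreover have "rec_nat 0 (\<lambda>k r. r + Suc k) a = triangle a" for a :: nat
    by (induction a) auto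
  ultimately have "computable2 (\<lambda>a b. triangle a)" by simp
  from computable_comp2[OF this computable_id computable_id] show ?thesis .
qed

abbreviation pair :: "nat \<Rightarrow> nat \<Rightarrow> nat" where
  "pair a b \<equiv> prod_encode (a, b)"

definition first :: "nat \<Rightarrow> nat" where
  "first z = fst (prod_decode z)"

definition second :: "nat \<Rightarrow> nat" where
  "second z = snd (prod_decode z)"

lemma first_pair [simp]: "first (pair a b) = a"
  and second_pair [simp]: "second (pair a b) = b"
  by (auto simp: first_def second_def)

lemma pair_first_second [simp]: "pair (first z) (second z) = z"
  by (simp add: first_def second_def)

lemma computable2_pair: "computable2 pair"
proof -
  have "computable2 (\<lambda>a b. triangle (a + b) + a)"
    unfolding computable2_def
    by (intro rec_fun_comp2[OF computable2_add] rec_fun_comp1[OF computable_triangle] rec_fun_proj)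
      auto
  then show ?thesis by (simp add: prod_encode_def)
qed

lemma triangle_mono: "a \<le> b \<Longrightarrow> triangle a \<le> triangle b"
  by (induction rule: dec_induct) auto

text \<open>The index of the diagonal on which the pair coded by a number lies.\<close>

definition diagonal :: "nat \<Rightarrow> nat" where
  "diagonal z = rec_nat 0 (\<lambda>k r. r + (1 - (triangle (Suc r) - Suc k))) z"

lemma computable_diagonal: "computable diagonal"
proof -
  have "computable2 (\<lambda>a b. rec_nat 0 (\<lambda>k r. r + (1 - (triangle (Suc r) - Suc k))) a)"
    by (intro computable2_rec computable_const rec_fun_comp2[OF computable2_add] rec_fun_const
        rec_fun_comp2[OF computable2_diff] rec_fun_comp1[OF computable_triangle]
        rec_fun_comp1[OF computable_succ] rec_fun_proj) auto
  then have "computable2 (\<lambda>a b. diagonal a)" by (simp add: diagonal_def)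
  from computable_comp2[OF this computable_id computable_id] show ?thesis .
qed

text \<open>The summand \<open>1 - (triangle (Suc r) - Suc k)\<close> is 1 exactly when
  \<open>triangle (Suc r) \<le> Suc k\<close>, that is, when the next diagonal is reached. One
  increment per step suffices because successive triangular numbers are distinct.\<close>

lemma diagonal_bounds: "triangle (diagonal z) \<le> z \<and> z < triangle (Suc (diagonal z))"
proof (induction z)
  case 0
  then show ?case by (simp add: diagonal_def)
next
  case (Suc z)
  have step: "diagonal (Suc z) = diagonal z + (1 - (triangle (Suc (diagonal z)) - Suc z))"
    by (simp add: diagonal_def)
  show ?case
  proof (cases "triangle (Suc (diagonal z)) \<le> Suc z")
    case True
    then have "diagonal (Suc z) = Suc (diagonal z)"
      using step by simp
    with True Suc show ?thesis by simp
  next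
    case False
    then have "diagonal (Suc z) = diagonal z"
      using step by simp
    with False Suc show ?thesis by simp
  qed
qed

lemma diagonal_pair: "diagonal (pair a b) = a + b"
proof -
  let ?d = "diagonal (pair a b)"
  have p: "pair a b = triangle (a + b) + a" by (simp add: prod_encode_def)
  have "\<not> ?d < a + b"
    using diagonal_bounds[of "pair a b"] triangle_mono[of "Suc ?d" "a + b"] p by linarith
  moreover have "\<not> a + b < ?d"
    using diagonal_bounds[of "pair a b"] triangle_mono[of "Suc (a + b)" ?d] p by auto
  ultimately show ?thesis by simp
qed

lemma first_eq: "first z = z - triangle (diagonal z)"
  and second_eq: "second z = diagonal z - first z"
proof -
  obtain a b where z: "z = pair a b" by (metis pair_first_second)
  show "first z = z - triangle (diagonal z)"
    unfolding z diagonal_pair first_pair by (simp add: prod_encode_def)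
  show "second z = diagonal z - first z"
    unfolding z diagonal_pair by simp
qed

lemma computable_add: "computable f \<Longrightarrow> computable g \<Longrightarrow> computable (\<lambda>x. f x + g x)"
  by (rule computable_comp2[OF computable2_add])

lemma computable_mult: "computable f \<Longrightarrow> computable g \<Longrightarrow> computable (\<lambda>x. f x * g x)"
  by (rule computable_comp2[OF computable2_mult])

lemma computable_diff: "computable f \<Longrightarrow> computable g \<Longrightarrow> computable (\<lambda>x. f x - g x)"
  by (rule computable_comp2[OF computable2_diff])

lemma computable_Suc: "computable f \<Longrightarrow> computable (\<lambda>x. Suc (f x))"
  by (rule computable_comp[OF computable_succ])

lemma computable_pair: "computable f \<Longrightarrow> computable g \<Longrightarrow> computable (\<lambda>x. pair (f x) (g x))"
  by (rule computable_comp2[OF computable2_pair])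

lemma computable_first: "computable f \<Longrightarrow> computable (\<lambda>x. first (f x))"
  unfolding first_eq
  by (intro computable_diff computable_comp[OF computable_triangle]
      computable_comp[OF computable_diagonal])

lemma computable_second: "computable f \<Longrightarrow> computable (\<lambda>x. second (f x))"
  unfolding second_eq
  by (intro computable_diff computable_first computable_comp[OF computable_diagonal])

text \<open>Packing \<open>k\<close>, \<open>r\<close> and \<open>x\<close> into one number keeps
  all functions unary, so that later computability proofs only apply introduction rules.\<close>

lemma computable_rec:
  assumes f: "computable f" and h: "computable h"
    and g: "computable (\<lambda>z. g (first z) (first (second z)) (second (second z)))"
  shows "computable (\<lambda>x. rec_nat (f x) (\<lambda>k r. g k r x) (h x))"
proof -
  have "rec_fun 3 (\<lambda>xs. pair (xs ! 0) (pair (xs ! 1) (xs ! 2)))"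
    by (intro rec_fun_comp2[OF computable2_pair] rec_fun_proj) auto
  from rec_fun_comp1[OF g this] have "computable2 (\<lambda>a b. rec_nat (f b) (\<lambda>k r. g k r b) a)"
    by (intro computable2_rec f) simp
  from computable_comp2[OF this h computable_id] show ?thesis .
qed

lemmas computable_intros = computable_id computable_const computable_Suc computable_add
  computable_mult computable_diff computable_pair computable_first computable_second

section \<open>Decidable predicates and bounded quantifiers\<close>

definition computable_pred :: "(nat \<Rightarrow> bool) \<Rightarrow> bool" where
  "computable_pred P \<longleftrightarrow> computable (\<lambda>x. of_bool (P x))"

lemma computable_pred_comp:
  "computable_pred P \<Longrightarrow> computable f \<Longrightarrow> computable_pred (\<lambda>x. P (f x))"
  unfolding computable_pred_def by (rule computable_comp)

lemma computable_pred_le: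
  assumes "computable f" "computable g"
  shows "computable_pred (\<lambda>x. f x \<le> g x)"
proof -
  have "computable (\<lambda>x. 1 - (f x - g x))"
    by (intro computable_intros assms)
  moreover have "1 - (a - b) = of_bool (a \<le> b)" for a b :: nat
    by auto
  ultimately show ?thesis
    unfolding computable_pred_def by simp
qed

lemma computable_pred_not: "computable_pred P \<Longrightarrow> computable_pred (\<lambda>x. \<not> P x)"
  unfolding computable_pred_def
proof -
  assume "computable (\<lambda>x. of_bool (P x))"
  then have "computable (\<lambda>x. 1 - of_bool (P x))"
    by (intro computable_diff computable_const)
  moreover have "1 - of_bool p = (of_bool (\<not> p) :: nat)" for p
    by simp
  ultimately show "computable (\<lambda>x. of_bool (\<not> P x))"
    by (simp only:)
qed

lemma computable_pred_conj:
  "computable_pred P \<Longrightarrow> computable_pred Q \<Longrightarrow> computable_pred (\<lambda>x. P x \<and> Q x)"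
  unfolding computable_pred_def of_bool_conj by (rule computable_mult)

lemma computable_pred_disj:
  "computable_pred P \<Longrightarrow> computable_pred Q \<Longrightarrow> computable_pred (\<lambda>x. P x \<or> Q x)"
  using computable_pred_not[OF computable_pred_conj[OF computable_pred_not computable_pred_not]]
  by simp

lemma computable_pred_imp:
  "computable_pred P \<Longrightarrow> computable_pred Q \<Longrightarrow> computable_pred (\<lambda>x. P x \<longrightarrow> Q x)"
  unfolding imp_conv_disj by (intro computable_pred_disj computable_pred_not)

lemma computable_pred_eq:
  "computable f \<Longrightarrow> computable g \<Longrightarrow> computable_pred (\<lambda>x. f x = g x)"
  unfolding eq_iff by (intro computable_pred_conj computable_pred_le)

text \<open>Summing truth values over \<open>k \<le> b x\<close> counts the witnesses. In the
  premise \<open>first z\<close> is the bound variable and \<open>second z\<close> the whole outer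
  context, so the rule applies again to nested quantifiers.\<close>

lemma computable_pred_ex:
  assumes P: "computable_pred (\<lambda>z. P (second z) (first z))" and b: "computable b"
  shows "computable_pred (\<lambda>x. \<exists>k\<le>b x. P x k)"
proof -
  have P': "computable (\<lambda>z. of_bool (P (second z) (first z)))"
    using P by (simp add: computable_pred_def)
  have "computable (\<lambda>x. rec_nat 0 (\<lambda>k r. r + of_bool (P x k)) (Suc (b x)))"
    using computable_comp[OF P' computable_pair[OF computable_first computable_second],
        of "\<lambda>z. z" second] computable_second[OF computable_id] computable_id
    by (intro computable_rec computable_intros b) simp
  moreover have "(rec_nat 0 (\<lambda>k r. r + of_bool (P x k)) (Suc m) = (0::nat)) \<longleftrightarrow> \<not> (\<exists>k\<le>m. P x k)"
    for x m
    by (induction m) (auto simp: le_Suc_eq)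
  ultimately have "computable_pred (\<lambda>x. \<not> (\<not> (\<exists>k\<le>b x. P x k)))"
    using computable_pred_not[OF computable_pred_eq[OF _ computable_const[of 0]],
        of "\<lambda>x. rec_nat 0 (\<lambda>k r. r + of_bool (P x k)) (Suc (b x))"]
    by (simp only:)
  then show ?thesis
    by (simp only: not_not)
qed

lemma computable_pred_all:
  assumes "computable_pred (\<lambda>z. P (second z) (first z))" "computable b"
  shows "computable_pred (\<lambda>x. \<forall>k\<le>b x. P x k)"
  using computable_pred_not[OF computable_pred_ex[OF computable_pred_not[OF assms(1)] assms(2)]]
  by simp

lemma computable_mod2: "computable f \<Longrightarrow> computable (\<lambda>x. f x mod 2)"
proof -
  assume f: "computable f"
  have "computable (\<lambda>x. rec_nat 0 (\<lambda>k r. 1 - r) (f x))"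
    by (intro computable_rec computable_intros f)
  moreover have "rec_nat 0 (\<lambda>k r. 1 - r) a = a mod 2" for a :: nat
    by (induction a) (auto simp: mod_Suc)
  ultimately show ?thesis by simp
qed

lemma computable_div2: "computable f \<Longrightarrow> computable (\<lambda>x. f x div 2)"
proof -
  assume f: "computable f"
  \<comment> \<open>\<open>a div 2\<close> is the number of odd numbers below
    \<open>a\<close>.\<close>
  have "computable (\<lambda>x. rec_nat 0 (\<lambda>k r. r + k mod 2) (f x))"
    by (intro computable_rec computable_intros computable_mod2 f)
  moreover have "rec_nat 0 (\<lambda>k r. r + k mod 2) a = a div 2" for a :: nat
    by (induction a) (auto, presburger)
  ultimately show ?thesis by simp
qed

lemma computable_power2: "computable f \<Longrightarrow> computable (\<lambda>x. 2 ^ f x)"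
proof -
  assume f: "computable f"
  have "computable (\<lambda>x. rec_nat 1 (\<lambda>k r. 2 * r) (f x))"
    by (intro computable_rec computable_intros f)
  moreover have "rec_nat 1 (\<lambda>k r. 2 * r) a = (2 :: nat) ^ a" for a :: nat
    by (induction a) auto
  ultimately show ?thesis by simp
qed

text \<open>\<open>set_decode\<close> reads a number as the set of positions of its binary digits 1,
  so membership is the parity after \<open>f x\<close> halvings.\<close>

lemma computable_pred_set_decode:
  assumes "computable f" "computable g"
  shows "computable_pred (\<lambda>x. f x \<in> set_decode (g x))"
proof -
  have "computable (\<lambda>x. rec_nat (g x) (\<lambda>k r. r div 2) (f x) mod 2)"
    by (intro computable_mod2 computable_rec computable_div2 computable_intros assms)
  moreover have "rec_nat b (\<lambda>k r. r div 2) a = b div 2 ^ a" for a b :: nat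
    by (induction a) (auto simp: mult.commute simp flip: div_mult2_eq)
  ultimately have "computable (\<lambda>x. of_bool (f x \<in> set_decode (g x)))"
    by (simp add: set_decode_def mod_2_eq_odd)
  then show ?thesis
    by (simp add: computable_pred_def)
qed

section \<open>Membership in coded lists\<close>

lemma length_le_list_encode: "length xs \<le> list_encode xs"
proof (induction xs)
  case (Cons x xs)
  then show ?case
    using le_prod_encode_2[of "list_encode xs" x] by simp
qed simp

text \<open>A nonempty list is coded by the successor of the pair of its head and the code of its
  tail, the empty list by 0. As 0 is also the pair of two zeros, the step maps 0 to 0 and running
  past the end is harmless.\<close>

lemma iterated_tail: "rec_nat (list_encode xs) (\<lambda>k r. second (r - 1)) n = list_encode (drop n xs)"
proof (induction n)
  case (Suc n)
  have "second (0 - 1) = 0"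
    using second_pair[of 0 0] by (simp add: prod_encode_def)
  then have "second (list_encode ys - 1) = list_encode (tl ys)" for ys
    by (cases ys) auto
  with Suc show ?case
    by (simp add: drop_Suc tl_drop)
qed simp

text \<open>A bounded search through the tails; since no list is longer than its code,
  \<open>k \<le> c\<close> reaches every position.\<close>

lemma mem_list_decode_iff:
  "n \<in> set (list_decode c) \<longleftrightarrow> (\<exists>k\<le>c. \<not> rec_nat c (\<lambda>k r. second (r - 1)) k = 0 \<and>
     first (rec_nat c (\<lambda>k r. second (r - 1)) k - 1) = n)"
proof -
  obtain xs where c: "c = list_encode xs" by (metis list_decode_inverse)
  have nz: "(list_encode ys = 0) \<longleftrightarrow> ys = []" for ys
    by (cases ys) auto
  have hd: "ys \<noteq> [] \<Longrightarrow> first (list_encode ys - 1) = hd ys" for ys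
    by (cases ys) auto
  show ?thesis
    unfolding c iterated_tail nz list_encode_inverse
  proof
    assume "n \<in> set xs"
    then obtain k where k: "k < length xs" "xs ! k = n"
      by (auto simp: in_set_conv_nth)
    then have "first (list_encode (drop k xs) - 1) = n"
      using hd[of "drop k xs"] by (simp add: hd_drop_conv_nth)
    with k length_le_list_encode[of xs]
    show "\<exists>k\<le>list_encode xs. drop k xs \<noteq> [] \<and> first (list_encode (drop k xs) - 1) = n"
      by (intro exI[of _ k]) simp
  next
    assume "\<exists>k\<le>list_encode xs. drop k xs \<noteq> [] \<and> first (list_encode (drop k xs) - 1) = n"
    then obtain k where k: "drop k xs \<noteq> []" "first (list_encode (drop k xs) - 1) = n"
      by blast
    with hd[of "drop k xs"] hd_in_set[of "drop k xs"] show "n \<in> set xs"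
      by (metis in_set_dropD)
  qed
qed

lemma computable_pred_list_decode:
  assumes "computable f" "computable g"
  shows "computable_pred (\<lambda>x. f x \<in> set (list_decode (g x)))"
proof -
  have "computable_pred (\<lambda>z. first z \<in> set (list_decode (second z)))"
    unfolding mem_list_decode_iff
    by (intro computable_pred_ex computable_pred_conj computable_pred_not computable_pred_eq
        computable_rec computable_intros)
  from computable_pred_comp[OF this computable_pair[OF assms]] show ?thesis
    by simp
qed

lemmas computable_pred_intros = computable_pred_le computable_pred_eq computable_pred_not
  computable_pred_conj computable_pred_disj computable_pred_imp computable_pred_all
  computable_pred_ex computable_pred_set_decode computable_pred_list_decode


section \<open>Fitting models\<close>

text \<open>Each condition matches one of the rules \<open>Ref\<close>, \<open>El_Sum\<close>,
  \<open>Er_Sum\<close>, \<open>E_App\<close> and \<open>IAN\<close>; rule \<open>E\<close> is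
  covered by the clause of \<open>sat\<close> for \<open>Just\<close>. The set \<open>W\<close> is
  explicit because the model serves both with all labels as worlds and with a finite set of
  numbers.\<close>

locale fitting_model =
  fixes CS :: "fm set"
    and W :: "'w set"
    and R :: "'w \<Rightarrow> 'w \<Rightarrow> bool"
    and Ev :: "'w \<Rightarrow> tm \<Rightarrow> fm \<Rightarrow> bool"
    and V :: "'w \<Rightarrow> nat \<Rightarrow> bool"
  assumes R_refl: "w \<in> W \<Longrightarrow> R w w"
    and Ev_Sum: "w \<in> W \<Longrightarrow> Ev w t A \<Longrightarrow> Ev w (Sum s t) A \<and> Ev w (Sum t s) A"
    and Ev_App: "w \<in> W \<Longrightarrow> Ev w s (Imp A B) \<Longrightarrow> Ev w t A \<Longrightarrow> Ev w (App s t) B"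
    and Ev_CS: "w \<in> W \<Longrightarrow> Just (JConst c) F \<in> CS \<Longrightarrow> Ev w (JConst c) F"
begin

primrec sat :: "fm \<Rightarrow> 'w \<Rightarrow> bool" where
  "sat (PVar p) w = V w p"
| "sat Bot w = False"
| "sat (Neg A) w = (\<not> sat A w)"
| "sat (And A B) w = (sat A w \<and> sat B w)"
| "sat (Or A B) w = (sat A w \<or> sat B w)"
| "sat (Imp A B) w = (sat A w \<longrightarrow> sat B w)"
| "sat (Just t A) w = (Ev w t A \<and> (\<forall>v\<in>W. R w v \<longrightarrow> sat A v))"

primrec holds :: "(label \<Rightarrow> 'w) \<Rightarrow> lfm \<Rightarrow> bool" where
  "holds I (Forces w A) = sat A (I w)"
| "holds I (Rel w v) = R (I w) (I v)"
| "holds I (Evid w t A) = Ev (I w) t A"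

lemma holds_cong: "(\<And>l. l \<in> labels \<phi> \<Longrightarrow> I l = J l) \<Longrightarrow> holds I \<phi> = holds J \<phi>"
  by (cases \<phi>) auto

lemma soundness:
  assumes "G3JT CS \<Gamma> \<Delta>" "range I \<subseteq> W" "\<forall>\<phi>\<in>#\<Gamma>. holds I \<phi>"
  shows "\<exists>\<phi>\<in>#\<Delta>. holds I \<phi>"
  using assms
proof (induction arbitrary: I)
  case (R_Just w v t A \<Gamma> \<Delta>)
  show ?case
  proof (cases "sat (Just t A) (I w)")
    case False
    then obtain u where u: "u \<in> W" "R (I w) u" "\<not> sat A u"
      using R_Just.prems by auto
    \<comment> \<open>The eigenvariable moves to a successor refuting \<open>A\<close>; by freshness
      all other formulas keep their value. This change of \<open>I\<close> is why the induction
      generalizes over it.\<close>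
    define J where "J = I(v := u)"
    have J: "holds J \<phi> = holds I \<phi>" if "v \<notin> labels \<phi>" for \<phi>
      by (rule holds_cong) (use that J_def in auto)
    have fresh: "v \<noteq> w" "\<And>\<phi>. \<phi> \<in># \<Gamma> \<Longrightarrow> v \<notin> labels \<phi>" "\<And>\<phi>. \<phi> \<in># \<Delta> \<Longrightarrow> v \<notin> labels \<phi>"
      using R_Just.hyps by (auto simp: labels_mset_def)
    have "range J \<subseteq> W"
      using R_Just.prems u by (auto simp: J_def)
    moreover have "\<forall>\<phi>\<in>#add_mset (Rel w v) (add_mset (Evid w t A) \<Gamma>). holds J \<phi>"
      using R_Just.prems u fresh J by (auto simp: J_def)
    ultimately have "\<exists>\<phi>\<in>#add_mset (Forces v A) \<Delta>. holds J \<phi>"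
      by (rule R_Just.IH)
    moreover have "\<not> holds J (Forces v A)"
      using u by (simp add: J_def)
    ultimately show ?thesis
      using J fresh by auto
  qed simp
next
  case (L_Just v A w t \<Gamma> \<Delta>)
  have "sat A (I v)"
    using L_Just.prems by auto
  with L_Just show ?case by simp
next
  case (El_Sum w s t A \<Gamma> \<Delta>)
  have "Ev (I w) (Sum s t) A \<and> Ev (I w) (Sum t s) A"
    by (rule Ev_Sum) (use El_Sum.prems in auto)
  with El_Sum show ?case by simp
next
  case (Er_Sum w t s A \<Gamma> \<Delta>)
  have "Ev (I w) (Sum s t) A \<and> Ev (I w) (Sum t s) A"
    by (rule Ev_Sum) (use Er_Sum.prems in auto)
  with Er_Sum show ?case by simp
next
  case (E_App w s t B A \<Gamma> \<Delta>)
  have "Ev (I w) (App s t) B"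
    by (rule Ev_App[of _ _ A]) (use E_App.prems in auto)
  then show ?case
    using E_App by auto
next
  case (IAN w c F \<Gamma> \<Delta>)
  have "Ev (I w) (JConst c) F"
    by (rule Ev_CS) (use IAN in auto)
  then show ?case
    using IAN by auto
next
  case (Ref w \<Gamma> \<Delta>)
  have "R (I w) (I w)"
    by (rule R_refl) (use Ref in auto)
  then show ?case
    using Ref by auto
next
  case L_Neg
  show ?case
    using L_Neg.IH[of I] L_Neg.prems by auto
next
  case R_Neg
  show ?case
    using R_Neg.IH[of I] R_Neg.prems by auto
next
  case L_And
  show ?case
    using L_And.IH[of I] L_And.prems by auto
next
  case R_And
  show ?case
    using R_And.IH(1)[of I] R_And.IH(2)[of I] R_And.prems by auto
next
  case L_Or
  show ?case
    using L_Or.IH(1)[of I] L_Or.IH(2)[of I] L_Or.prems by auto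
next
  case R_Or
  show ?case
    using R_Or.IH[of I] R_Or.prems by auto
next
  case L_Imp
  show ?case
    using L_Imp.IH(1)[of I] L_Imp.IH(2)[of I] L_Imp.prems by auto
next
  case R_Imp
  show ?case
    using R_Imp.IH[of I] R_Imp.prems by auto
next
  case E
  show ?case
    using E.IH[of I] E.prems by auto
qed auto

end


section \<open>Completeness\<close>

text \<open>The components that justify removing a decomposed formula from one side of a sequent.\<close>

fun left_done :: "sequent \<Rightarrow> lfm \<Rightarrow> bool" where
  "left_done (\<Gamma>, \<Delta>) (Forces w (Neg A)) = (Forces w A \<in># \<Delta>)"
| "left_done (\<Gamma>, \<Delta>) (Forces w (And A B)) = (Forces w A \<in># \<Gamma> \<and> Forces w B \<in># \<Gamma>)"
| "left_done (\<Gamma>, \<Delta>) (Forces w (Or A B)) = (Forces w A \<in># \<Gamma> \<or> Forces w B \<in># \<Gamma>)"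
| "left_done (\<Gamma>, \<Delta>) (Forces w (Imp A B)) = (Forces w A \<in># \<Delta> \<or> Forces w B \<in># \<Gamma>)"
| "left_done _ _ = False"

fun right_done :: "sequent \<Rightarrow> lfm \<Rightarrow> bool" where
  "right_done (\<Gamma>, \<Delta>) (Forces w (Neg A)) = (Forces w A \<in># \<Gamma>)"
| "right_done (\<Gamma>, \<Delta>) (Forces w (And A B)) = (Forces w A \<in># \<Delta> \<or> Forces w B \<in># \<Delta>)"
| "right_done (\<Gamma>, \<Delta>) (Forces w (Or A B)) = (Forces w A \<in># \<Delta> \<and> Forces w B \<in># \<Delta>)"
| "right_done (\<Gamma>, \<Delta>) (Forces w (Imp A B)) = (Forces w A \<in># \<Gamma> \<and> Forces w B \<in># \<Delta>)"
| "right_done (\<Gamma>, \<Delta>) (Forces w (Just t A)) = (\<exists>v. Rel w v \<in># \<Gamma> \<and> Forces v A \<in># \<Delta>)"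
| "right_done _ _ = False"

fun left_active :: "lfm \<Rightarrow> bool" where
  "left_active (Forces w (Neg A)) = True"
| "left_active (Forces w (And A B)) = True"
| "left_active (Forces w (Or A B)) = True"
| "left_active (Forces w (Imp A B)) = True"
| "left_active _ = False"

text \<open>\<open>R_Just\<close> also has an evidence atom as principal formula, so
  \<open>Just t A\<close> on the right waits for this atom. If it never appears,
  \<open>Just t A\<close> fails for lack of evidence.\<close>

fun right_active :: "lfm multiset \<Rightarrow> lfm \<Rightarrow> bool" where
  "right_active \<Gamma> (Forces w (Neg A)) = True"
| "right_active \<Gamma> (Forces w (And A B)) = True"
| "right_active \<Gamma> (Forces w (Or A B)) = True"
| "right_active \<Gamma> (Forces w (Imp A B)) = True"
| "right_active \<Gamma> (Forces w (Just t A)) = (Evid w t A \<in># \<Gamma>)"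
| "right_active _ _ = False"

text \<open>The cumulative rules: their premise repeats the principal formulas, so read upwards they
  only add \<open>\<phi>\<close> and never undo the effect of another step.\<close>

inductive addable :: "fm set \<Rightarrow> lfm set \<Rightarrow> lfm \<Rightarrow> bool" for CS G where
  "Forces w (Just t A) \<in> G \<Longrightarrow> Rel w v \<in> G \<Longrightarrow> addable CS G (Forces v A)"
| "Forces w (Just t A) \<in> G \<Longrightarrow> addable CS G (Evid w t A)"
| "Evid w t A \<in> G \<Longrightarrow> addable CS G (Evid w (Sum s t) A)"
| "Evid w t A \<in> G \<Longrightarrow> addable CS G (Evid w (Sum t s) A)"
| "Evid w s (Imp A B) \<in> G \<Longrightarrow> Evid w t A \<in> G \<Longrightarrow> addable CS G (Evid w (App s t) B)"
| "Just (JConst c) F \<in> CS \<Longrightarrow> addable CS G (Evid w (JConst c) F)"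
| "addable CS G (Rel w w)"

text \<open>\<open>addable\<close> sees only which formulas occur, whereas a rule with two principal
  formulas needs two separate occurrences. The two are always different formulas, so contraction is
  not called for.\<close>

lemma G3JT_addable:
  assumes "addable CS (set_mset \<Gamma>) \<phi>" "G3JT CS (add_mset \<phi> \<Gamma>) \<Delta>"
  shows "G3JT CS \<Gamma> \<Delta>"
  using assms(1)
proof cases
  case (1 w t A v)
  then obtain \<Gamma>' where "\<Gamma> = add_mset (Forces w (Just t A)) (add_mset (Rel w v) \<Gamma>')"
    by (metis insert_DiffM insert_noteq_member lfm.distinct(1))
  then show ?thesis
    using assms(2) 1(1) L_Just by simp
next
  case (2 w t A)
  then obtain \<Gamma>' where "\<Gamma> = add_mset (Forces w (Just t A)) \<Gamma>'"
    by (metis insert_DiffM)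
  then show ?thesis
    using assms(2) 2(1) E by simp
next
  case (3 w t A s)
  then obtain \<Gamma>' where "\<Gamma> = add_mset (Evid w t A) \<Gamma>'"
    by (metis insert_DiffM)
  then show ?thesis
    using assms(2) 3(1) El_Sum by simp
next
  case (4 w t A s)
  then obtain \<Gamma>' where "\<Gamma> = add_mset (Evid w t A) \<Gamma>'"
    by (metis insert_DiffM)
  then show ?thesis
    using assms(2) 4(1) Er_Sum by simp
next
  case (5 w s A B t)
  \<comment> \<open>An implication is larger than its antecedent.\<close>
  have "Evid w s (Imp A B) \<noteq> Evid w t A"
  proof
    assume "Evid w s (Imp A B) = Evid w t A"
    then have "size (Imp A B) = size A"
      by (simp del: fm.size)
    then show False
      by simp
  qed
  with 5 obtain \<Gamma>' where "\<Gamma> = add_mset (Evid w s (Imp A B)) (add_mset (Evid w t A) \<Gamma>')"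
    by (metis insert_DiffM insert_noteq_member)
  then show ?thesis
    using assms(2) 5(1) E_App by simp
next
  case (6 c F w)
  then show ?thesis
    using assms(2) IAN by simp
next
  case (7 w)
  then show ?thesis
    using assms(2) Ref by simp
qed

definition extends :: "sequent \<Rightarrow> sequent \<Rightarrow> bool" where
  "extends S T \<longleftrightarrow>
     (\<forall>\<phi>\<in>#fst S. \<phi> \<in># fst T \<or> left_done T \<phi>) \<and> (\<forall>\<phi>\<in>#snd S. \<phi> \<in># snd T \<or> right_done T \<phi>)"

definition underivable :: "fm set \<Rightarrow> sequent \<Rightarrow> bool" where
  "underivable CS S \<longleftrightarrow> \<not> G3JT CS (fst S) (snd S)"

lemma left_step:
  assumes "underivable CS S"
  shows "\<exists>T. underivable CS T \<and> extends S T \<and>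
    (left_active \<phi> \<longrightarrow> \<phi> \<in># fst S \<longrightarrow> left_done T \<phi>)"
proof (cases "left_active \<phi> \<and> \<phi> \<in># fst S")
  case False
  then show ?thesis
    using assms by (intro exI[of _ S]) (auto simp: extends_def)
next
  case True
  then obtain \<Gamma> where S: "S = (add_mset \<phi> \<Gamma>, snd S)"
    by (metis insert_DiffM prod.collapse)
  define \<Delta> where "\<Delta> = snd S"
  have u: "\<not> G3JT CS (add_mset \<phi> \<Gamma>) \<Delta>"
    using assms S \<Delta>_def by (metis underivable_def fst_conv)
  have "\<exists>T. underivable CS T \<and> extends (add_mset \<phi> \<Gamma>, \<Delta>) T \<and> left_done T \<phi>"
    using True[THEN conjunct1]
  proof (cases \<phi> rule: left_active.cases)
    case (1 w A)
    with u L_Neg show ?thesis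
      by (intro exI[of _ "(\<Gamma>, add_mset (Forces w A) \<Delta>)"]) (auto simp: underivable_def extends_def)
  next
    case (2 w A B)
    with u L_And show ?thesis
      by (intro exI[of _ "(add_mset (Forces w A) (add_mset (Forces w B) \<Gamma>), \<Delta>)"])
        (auto simp: underivable_def extends_def)
  next
    case (3 w A B)
    with u L_Or consider "\<not> G3JT CS (add_mset (Forces w A) \<Gamma>) \<Delta>"
      | "\<not> G3JT CS (add_mset (Forces w B) \<Gamma>) \<Delta>"
      by blast
    then show ?thesis
    proof cases
      case 1
      with 3 show ?thesis
        by (intro exI[of _ "(add_mset (Forces w A) \<Gamma>, \<Delta>)"]) (auto simp: underivable_def extends_def)
    next
      case 2
      with 3 show ?thesis
        by (intro exI[of _ "(add_mset (Forces w B) \<Gamma>, \<Delta>)"]) (auto simp: underivable_def extends_def)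
    qed
  next
    case (4 w A B)
    with u L_Imp consider "\<not> G3JT CS \<Gamma> (add_mset (Forces w A) \<Delta>)"
      | "\<not> G3JT CS (add_mset (Forces w B) \<Gamma>) \<Delta>"
      by blast
    then show ?thesis
    proof cases
      case 1
      with 4 show ?thesis
        by (intro exI[of _ "(\<Gamma>, add_mset (Forces w A) \<Delta>)"]) (auto simp: underivable_def extends_def)
    next
      case 2
      with 4 show ?thesis
        by (intro exI[of _ "(add_mset (Forces w B) \<Gamma>, \<Delta>)"]) (auto simp: underivable_def extends_def)
    qed
  qed auto
  then show ?thesis
    using S \<Delta>_def by auto
qed

lemma finite_labels_mset: "finite (labels_mset \<Gamma>)"
proof -
  have "finite (labels \<phi>)" for \<phi>
    by (cases \<phi>) auto
  then show ?thesis
    by (simp add: labels_mset_def)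
qed

lemma right_step:
  assumes "underivable CS S"
  shows "\<exists>T. underivable CS T \<and> extends S T \<and>
    (right_active (fst S) \<phi> \<longrightarrow> \<phi> \<in># snd S \<longrightarrow> right_done T \<phi>)"
proof (cases "right_active (fst S) \<phi> \<and> \<phi> \<in># snd S")
  case False
  then show ?thesis
    using assms by (intro exI[of _ S]) (auto simp: extends_def)
next
  case True
  then obtain \<Delta> where S: "S = (fst S, add_mset \<phi> \<Delta>)"
    by (metis insert_DiffM prod.collapse)
  define \<Gamma> where "\<Gamma> = fst S"
  have u: "\<not> G3JT CS \<Gamma> (add_mset \<phi> \<Delta>)"
    using assms S \<Gamma>_def by (metis underivable_def snd_conv)
  have "\<exists>T. underivable CS T \<and> extends (\<Gamma>, add_mset \<phi> \<Delta>) T \<and> right_done T \<phi>"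
    using True[THEN conjunct1, folded \<Gamma>_def]
  proof (cases "(\<Gamma>, \<phi>)" rule: right_active.cases)
    case (1 \<Gamma>' w A)
    with u R_Neg show ?thesis
      by (intro exI[of _ "(add_mset (Forces w A) \<Gamma>, \<Delta>)"]) (auto simp: underivable_def extends_def)
  next
    case (2 \<Gamma>' w A B)
    with u R_And consider "\<not> G3JT CS \<Gamma> (add_mset (Forces w A) \<Delta>)"
      | "\<not> G3JT CS \<Gamma> (add_mset (Forces w B) \<Delta>)"
      by blast
    then show ?thesis
    proof cases
      case 1
      with 2 show ?thesis
        by (intro exI[of _ "(\<Gamma>, add_mset (Forces w A) \<Delta>)"]) (auto simp: underivable_def extends_def)
    next
      case 2
      with \<open>(\<Gamma>, \<phi>) = _\<close> show ?thesis
        by (intro exI[of _ "(\<Gamma>, add_mset (Forces w B) \<Delta>)"]) (auto simp: underivable_def extends_def)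
    qed
  next
    case (3 \<Gamma>' w A B)
    with u R_Or show ?thesis
      by (intro exI[of _ "(\<Gamma>, add_mset (Forces w A) (add_mset (Forces w B) \<Delta>))"])
        (auto simp: underivable_def extends_def)
  next
    case (4 \<Gamma>' w A B)
    with u R_Imp show ?thesis
      by (intro exI[of _ "(add_mset (Forces w A) \<Gamma>, add_mset (Forces w B) \<Delta>)"])
        (auto simp: underivable_def extends_def)
  next
    case (5 \<Gamma>' w t A)
    then have "Evid w t A \<in># \<Gamma>"
      using True \<Gamma>_def by auto
    then obtain \<Gamma>0 where \<Gamma>0: "\<Gamma> = add_mset (Evid w t A) \<Gamma>0"
      by (metis insert_DiffM)
    obtain v where "v \<notin> labels_mset (add_mset (Evid w t A) \<Gamma>0) \<union> labels_mset (add_mset \<phi> \<Delta>)"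
      using ex_new_if_finite[OF infinite_UNIV_nat] finite_labels_mset by (metis finite_Un)
    then have "\<not> G3JT CS (add_mset (Rel w v) \<Gamma>) (add_mset (Forces v A) \<Delta>)"
      using u R_Just[of CS w v t A \<Gamma>0 \<Delta>] 5 \<Gamma>0 by auto
    with 5 show ?thesis
      by (intro exI[of _ "(add_mset (Rel w v) \<Gamma>, add_mset (Forces v A) \<Delta>)"])
        (auto simp: underivable_def extends_def)
  qed auto
  then show ?thesis
    using S \<Gamma>_def by auto
qed

lemma add_step:
  assumes "underivable CS S"
  shows "\<exists>T. underivable CS T \<and> extends S T \<and>
    (addable CS (set_mset (fst S)) \<phi> \<longrightarrow> \<phi> \<in># fst T)"
proof (cases "addable CS (set_mset (fst S)) \<phi>")
  case False
  then show ?thesis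
    using assms by (intro exI[of _ S]) (auto simp: extends_def)
next
  case True
  with assms G3JT_addable show ?thesis
    by (intro exI[of _ "(add_mset \<phi> (fst S), snd S)"]) (auto simp: underivable_def extends_def)
qed

text \<open>Every underivable sequent starts an infinite branch of underivable sequents on which each
  labeled formula is treated infinitely often by each kind of step. Removed formulas leave their
  components on the branch, so the union of the branch is saturated, without any appeal to
  structural rules.\<close>

definition treated :: "fm set \<Rightarrow> nat \<Rightarrow> lfm \<Rightarrow> sequent \<Rightarrow> sequent \<Rightarrow> bool" where
  "treated CS k \<phi> S T \<longleftrightarrow>
     (k = 0 \<longrightarrow> left_active \<phi> \<longrightarrow> \<phi> \<in># fst S \<longrightarrow> left_done T \<phi>) \<and>
     (k = 1 \<longrightarrow> right_active (fst S) \<phi> \<longrightarrow> \<phi> \<in># snd S \<longrightarrow> right_done T \<phi>) \<and>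
     (k = 2 \<longrightarrow> addable CS (set_mset (fst S)) \<phi> \<longrightarrow> \<phi> \<in># fst T)"

lemma step_exists:
  assumes "underivable CS S"
  shows "\<exists>T. underivable CS T \<and> extends S T \<and> treated CS k \<phi> S T"
proof -
  consider "k = 0" | "k = 1" | "k = 2" | "k \<notin> {0, 1, 2}" by blast
  then show ?thesis
  proof cases
    case 1 with left_step[OF assms, of \<phi>] show ?thesis by (auto simp: treated_def)
  next
    case 2 with right_step[OF assms, of \<phi>] show ?thesis by (auto simp: treated_def)
  next
    case 3 with add_step[OF assms, of \<phi>] show ?thesis by (auto simp: treated_def)
  next
    case 4 with assms show ?thesis
      by (intro exI[of _ S]) (auto simp: treated_def extends_def)
  qed
qed

lemma fair_branch:
  assumes "underivable CS S"
  obtains b where "b 0 = S" "\<And>n. underivable CS (b n)" "\<And>n. extends (b n) (b (Suc n))"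
    "\<And>k \<phi> n. \<exists>m\<ge>n. treated CS k \<phi> (b m) (b (Suc m))"
proof -
  \<comment> \<open>Stage \<open>n\<close> serves the task in the first component of
    \<open>n\<close>. The second component is padding that makes every task recur beyond any given
    stage. Kinds above 2 impose nothing.\<close>
  define task where "task n = fst (prod_decode n)" for n
  define kind where "kind n = fst (prod_decode (task n))" for n
  define arg where "arg n = inv lfm_code (snd (prod_decode (task n)))" for n
  have "\<exists>b. \<forall>n. (underivable CS (b n) \<and> (n = 0 \<longrightarrow> b n = S)) \<and>
      (extends (b n) (b (Suc n)) \<and> treated CS (kind n) (arg n) (b n) (b (Suc n)))"
  proof (rule dependent_nat_choice)
    show "\<exists>T. underivable CS T \<and> ((0 :: nat) = 0 \<longrightarrow> T = S)"
      using assms by blast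
  next
    fix T :: sequent and n :: nat
    assume "underivable CS T \<and> (n = 0 \<longrightarrow> T = S)"
    then show "\<exists>U. (underivable CS U \<and> (Suc n = 0 \<longrightarrow> U = S)) \<and>
        (extends T U \<and> treated CS (kind n) (arg n) T U)"
      using step_exists[of CS T "kind n" "arg n"] by auto
  qed
  then obtain b where b: "b 0 = S" "\<And>n. underivable CS (b n)" "\<And>n. extends (b n) (b (Suc n))"
    "\<And>n. treated CS (kind n) (arg n) (b n) (b (Suc n))"
    by blast
  have "\<exists>m\<ge>n. treated CS k \<phi> (b m) (b (Suc m))" for k \<phi> n
  proof -
    define m where "m = prod_encode (prod_encode (k, lfm_code \<phi>), n)"
    have "inj lfm_code"
      by (simp add: inj_def lfm_code_inject)
    then have "kind m = k" "arg m = \<phi>"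
      by (simp_all add: m_def task_def kind_def arg_def)
    moreover have "n \<le> m"
      by (simp add: m_def le_prod_encode_2)
    ultimately show ?thesis
      using b(4)[of m] by auto
  qed
  with b(1-3) show ?thesis
    by (rule that)
qed

text \<open>The labels are the worlds, and \<open>R\<close>, \<open>Ev\<close> and \<open>V\<close>
  are read off the formulas that ever occur on the left. Decomposed formulas may disappear, but
  atoms and formulas \<open>Just t A\<close> on the left stay, and only these must meet in a single
  sequent.\<close>

lemma completeness:
  assumes "\<not> G3JT CS \<Gamma> \<Delta>"
  obtains R Ev V where "fitting_model CS (UNIV :: label set) R Ev"
    "\<forall>\<phi>\<in>#\<Gamma>. fitting_model.holds UNIV R Ev V id \<phi>"
    "\<forall>\<phi>\<in>#\<Delta>. \<not> fitting_model.holds UNIV R Ev V id \<phi>"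
proof -
  obtain b where b: "b 0 = (\<Gamma>, \<Delta>)" "\<And>n. underivable CS (b n)"
    "\<And>n. extends (b n) (b (Suc n))" "\<And>k \<phi> n. \<exists>m\<ge>n. treated CS k \<phi> (b m) (b (Suc m))"
    using fair_branch[of CS "(\<Gamma>, \<Delta>)"] assms by (auto simp: underivable_def)
  define G where "G = (\<Union>n. set_mset (fst (b n)))"
  define D where "D = (\<Union>n. set_mset (snd (b n)))"
  have left_Suc: "\<phi> \<in># fst (b (Suc n)) \<or> left_done (b (Suc n)) \<phi>" if "\<phi> \<in># fst (b n)" for \<phi> n
    using b(3)[of n] that unfolding extends_def by blast
  have right_Suc: "\<phi> \<in># snd (b (Suc n)) \<or> right_done (b (Suc n)) \<phi>" if "\<phi> \<in># snd (b n)" for \<phi> n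
    using b(3)[of n] that unfolding extends_def by blast
  have left: "\<phi> \<in># fst (b m) \<or> (\<exists>k. left_done (b k) \<phi>)" if "\<phi> \<in># fst (b n)" "n \<le> m" for \<phi> n m
    using that(2,1) by (induction rule: dec_induct) (use left_Suc in blast)+
  have right: "\<phi> \<in># snd (b m) \<or> (\<exists>k. right_done (b k) \<phi>)" if "\<phi> \<in># snd (b n)" "n \<le> m" for \<phi> n m
    using that(2,1) by (induction rule: dec_induct) (use right_Suc in blast)+
  have left_keep: "\<phi> \<in># fst (b m)" if "\<phi> \<in># fst (b n)" "n \<le> m" "\<not> left_active \<phi>" for \<phi> n m
  proof -
    have "\<not> left_done (b k) \<phi>" for k
      using that(3) by (cases "(b k, \<phi>)" rule: left_done.cases) auto
    with left[OF that(1,2)] show ?thesis by blast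
  qed
  have right_keep: "\<phi> \<in># snd (b m)"
    if "\<phi> \<in># snd (b n)" "n \<le> m" "\<And>k. \<not> right_done (b k) \<phi>" for \<phi> n m
    using right[OF that(1,2)] that(3) by blast
  have left_G: "\<exists>k. left_done (b k) \<phi>" if "\<phi> \<in> G" and act: "left_active \<phi>" for \<phi>
  proof -
    obtain n where n: "\<phi> \<in># fst (b n)"
      using \<open>\<phi> \<in> G\<close> by (auto simp: G_def)
    obtain m where "m \<ge> n" "treated CS 0 \<phi> (b m) (b (Suc m))"
      using b(4) by blast
    with left[OF n, of m] act show ?thesis
      by (auto simp: treated_def)
  qed
  \<comment> \<open>Activity is assumed only from a stage \<open>n0\<close> on, because the evidence
    atom that activates \<open>Just t A\<close> may turn up late. Fairness yields a treatment after
    both \<open>n\<close> and \<open>n0\<close>.\<close>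
  have right_D: "\<exists>k. right_done (b k) \<phi>"
    if "\<phi> \<in> D" and act: "\<And>m. n0 \<le> m \<Longrightarrow> right_active (fst (b m)) \<phi>" for \<phi> n0
  proof -
    obtain n where n: "\<phi> \<in># snd (b n)"
      using \<open>\<phi> \<in> D\<close> by (auto simp: D_def)
    obtain m where "m \<ge> max n n0" "treated CS 1 \<phi> (b m) (b (Suc m))"
      using b(4) by blast
    with right[OF n, of m] act[of m] show ?thesis
      by (auto simp: treated_def)
  qed
  have branch_D: "\<exists>\<Gamma>' \<Delta>'. b k = (\<Gamma>', \<Delta>') \<and> set_mset \<Gamma>' \<subseteq> G \<and> set_mset \<Delta>' \<subseteq> D" for k
    unfolding G_def D_def by (intro exI[of _ "fst (b k)"] exI[of _ "snd (b k)"]) auto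
  \<comment> \<open>Multisets inside \<open>G\<close> and \<open>D\<close> are enough here:
    unfolding \<open>left_done\<close> then turns its memberships into memberships in
    \<open>G\<close> and \<open>D\<close>.\<close>
  have saturated_left: "\<exists>\<Gamma>' \<Delta>'. set_mset \<Gamma>' \<subseteq> G \<and> set_mset \<Delta>' \<subseteq> D \<and> left_done (\<Gamma>', \<Delta>') \<phi>"
    if "\<phi> \<in> G" "left_active \<phi>" for \<phi>
    using left_G[OF that] branch_D by metis
  have right_doneD: "\<exists>\<Gamma>' \<Delta>'. set_mset \<Gamma>' \<subseteq> G \<and> set_mset \<Delta>' \<subseteq> D \<and> right_done (\<Gamma>', \<Delta>') \<phi>"
    if "right_done (b k) \<phi>" for k \<phi>
    using that branch_D by metis
  have saturated_right: "\<exists>\<Gamma>' \<Delta>'. set_mset \<Gamma>' \<subseteq> G \<and> set_mset \<Delta>' \<subseteq> D \<and> right_done (\<Gamma>', \<Delta>') \<phi>"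
    if "\<phi> \<in> D" "\<And>\<Gamma>. right_active \<Gamma> \<phi>" for \<phi>
    using right_D[OF that(1)] that(2) right_doneD by metis
  \<comment> \<open>Persistence brings formulas from different stages into one sequent, where a rule
    with two principal formulas can use them.\<close>
  have two: "\<exists>n. \<forall>m\<ge>n. \<phi> \<in># fst (b m) \<and> \<psi> \<in># fst (b m)"
    if "\<phi> \<in> G" "\<psi> \<in> G" and keep: "\<not> left_active \<phi>" "\<not> left_active \<psi>" for \<phi> \<psi>
  proof -
    obtain n k where "\<phi> \<in># fst (b n)" "\<psi> \<in># fst (b k)"
      using \<open>\<phi> \<in> G\<close> \<open>\<psi> \<in> G\<close> by (auto simp: G_def)
    with left_keep keep show ?thesis
      by (intro exI[of _ "max n k"]) auto
  qed
  have add_G: "\<phi> \<in> G" if add: "\<And>m. n \<le> m \<Longrightarrow> addable CS (set_mset (fst (b m))) \<phi>" for \<phi> n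
  proof -
    obtain m where "m \<ge> n" "treated CS 2 \<phi> (b m) (b (Suc m))"
      using b(4) by blast
    with add[of m] have "\<phi> \<in># fst (b (Suc m))"
      by (simp add: treated_def)
    then show ?thesis by (auto simp: G_def)
  qed
  have add2: "\<chi> \<in> G" if G: "\<phi> \<in> G" "\<psi> \<in> G" "\<not> left_active \<phi>" "\<not> left_active \<psi>"
    and add: "\<And>S. \<phi> \<in> S \<Longrightarrow> \<psi> \<in> S \<Longrightarrow> addable CS S \<chi>" for \<phi> \<psi> \<chi>
  proof -
    obtain n where "\<forall>m\<ge>n. \<phi> \<in># fst (b m) \<and> \<psi> \<in># fst (b m)"
      using two[OF G] by blast
    then show ?thesis
      by (intro add_G[of n] add) simp_all
  qed
  \<comment> \<open>Otherwise both occurrences would persist into one sequent of the branch, which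
    would then be initial.\<close>
  have disjoint: "\<not> (\<phi> \<in> G \<and> \<phi> \<in> D)"
    if keep: "\<not> left_active \<phi>" "\<And>k. \<not> right_done (b k) \<phi>"
      and init: "\<And>\<Gamma> \<Delta>. G3JT CS (add_mset \<phi> \<Gamma>) (add_mset \<phi> \<Delta>)" for \<phi>
  proof
    assume "\<phi> \<in> G \<and> \<phi> \<in> D"
    then obtain n k where "\<phi> \<in># fst (b n)" "\<phi> \<in># snd (b k)"
      by (auto simp: G_def D_def)
    with keep have "\<phi> \<in># fst (b (max n k))" "\<phi> \<in># snd (b (max n k))"
      using left_keep[of \<phi> n "max n k"] right_keep[of \<phi> k "max n k"] by auto
    then obtain \<Gamma>' \<Delta>' where "fst (b (max n k)) = add_mset \<phi> \<Gamma>'" "snd (b (max n k)) = add_mset \<phi> \<Delta>'"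
      by (blast dest: multi_member_split)
    with init[of \<Gamma>' \<Delta>'] b(2)[of "max n k"] show False
      by (simp add: underivable_def)
  qed
  define R where "R w v \<longleftrightarrow> Rel w v \<in> G" for w v
  define Ev where "Ev w t A \<longleftrightarrow> Evid w t A \<in> G" for w t A
  define V where "V w p \<longleftrightarrow> Forces w (PVar p) \<in> G" for w p
  have right_done_atom: "\<not> right_done (b k) (Rel w v)" "\<not> right_done (b k) (Evid w t A)"
    "\<not> right_done (b k) (Forces w (PVar p))" for k w v t A p
    by (cases "b k"; simp)+
  have model: "fitting_model CS (UNIV :: label set) R Ev"
  proof
    show "R w w" for w
      unfolding R_def by (rule add_G[of 0], rule addable.intros(7))
    show "Ev w (Sum s t) A \<and> Ev w (Sum t s) A" if "Ev w t A" for w s t A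
    proof -
      have E: "Evid w t A \<in> G"
        using that by (simp only: Ev_def)
      have "Evid w (Sum s t) A \<in> G" "Evid w (Sum t s) A \<in> G"
        by (rule add2[OF E E]; simp add: addable.intros(3,4))+
      then show ?thesis
        by (simp only: Ev_def)
    qed
    show "Ev w (App s t) B" if "Ev w s (Imp A B)" "Ev w t A" for w s t A B
    proof -
      have E: "Evid w s (Imp A B) \<in> G" "Evid w t A \<in> G"
        using that by (simp_all only: Ev_def)
      have "Evid w (App s t) B \<in> G"
        by (rule add2[OF E]) (simp_all, rule addable.intros(5))
      then show ?thesis
        by (simp only: Ev_def)
    qed
    show "Ev w (JConst c) F" if "Just (JConst c) F \<in> CS" for w c F
      unfolding Ev_def by (rule add_G[of 0], rule addable.intros(6)[OF that])
  qed
  interpret fitting_model CS "UNIV :: label set" R Ev V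
    by (fact model)
  have sat_Just: "sat (Just t A) w \<longleftrightarrow> Evid w t A \<in> G \<and> (\<forall>v. Rel w v \<in> G \<longrightarrow> sat A v)" for t A w
    by (simp only: sat.simps R_def[symmetric] Ev_def[symmetric]) simp
  have holds_atom: "holds id (Rel w v) \<longleftrightarrow> Rel w v \<in> G" "holds id (Evid w t A) \<longleftrightarrow> Evid w t A \<in> G"
    for w v t A
    by (simp only: holds.simps id_apply, simp only: R_def Ev_def)+
  \<comment> \<open>Both sides are treated together because negation and implication move formulas
    across the sequent.\<close>
  have truth: "(Forces w A \<in> G \<longrightarrow> sat A w) \<and> (Forces w A \<in> D \<longrightarrow> \<not> sat A w)" for w A
  proof (induction A arbitrary: w)
    case (PVar p)
    have "sat (PVar p) w \<longleftrightarrow> Forces w (PVar p) \<in> G"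
      by (simp only: sat.simps) (simp only: V_def)
    moreover have "\<not> (Forces w (PVar p) \<in> G \<and> Forces w (PVar p) \<in> D)"
      by (rule disjoint) (simp_all add: right_done_atom init_PVar)
    ultimately show ?case by blast
  next
    case Bot
    have "Forces w Bot \<notin> G"
    proof
      assume "Forces w Bot \<in> G"
      then obtain n where "Forces w Bot \<in># fst (b n)"
        by (auto simp: G_def)
      then obtain \<Gamma>' where "fst (b n) = add_mset (Forces w Bot) \<Gamma>'"
        by (blast dest: multi_member_split)
      with b(2)[of n] init_Bot[of CS w \<Gamma>'] show False
        by (simp add: underivable_def)
    qed
    then show ?case by simp
  next
    case (Neg A)
    show ?case
      using saturated_left[of "Forces w (Neg A)"] saturated_right[of "Forces w (Neg A)"] Neg.IH[of w]
      by auto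
  next
    case (And A B)
    show ?case
      using saturated_left[of "Forces w (And A B)"] saturated_right[of "Forces w (And A B)"]
        And.IH(1)[of w] And.IH(2)[of w]
      by auto
  next
    case (Or A B)
    show ?case
      using saturated_left[of "Forces w (Or A B)"] saturated_right[of "Forces w (Or A B)"]
        Or.IH(1)[of w] Or.IH(2)[of w]
      by auto
  next
    case (Imp A B)
    show ?case
      using saturated_left[of "Forces w (Imp A B)"] saturated_right[of "Forces w (Imp A B)"]
        Imp.IH(1)[of w] Imp.IH(2)[of w]
      by auto
  next
    case (Just t A)
    have "sat (Just t A) w" if J: "Forces w (Just t A) \<in> G"
    proof -
      have "Evid w t A \<in> G"
        by (rule add2[OF J J]) (simp_all add: addable.intros(2))
      moreover have "Forces v A \<in> G" if "Rel w v \<in> G" for v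
        by (rule add2[OF J that]) (simp_all add: addable.intros(1))
      ultimately show ?thesis
        using Just.IH by (simp only: sat_Just) blast
    qed
    moreover have "\<not> sat (Just t A) w" if J: "Forces w (Just t A) \<in> D"
    proof (cases "Evid w t A \<in> G")
      case True
      then obtain n where "\<forall>m\<ge>n. Evid w t A \<in># fst (b m)"
        using two[OF True True] by auto
      then have "\<exists>k. right_done (b k) (Forces w (Just t A))"
        by (intro right_D[OF J, of n]) auto
      then obtain v where "Rel w v \<in> G" "Forces v A \<in> D"
        using right_doneD by fastforce
      then show ?thesis
        using Just.IH by (simp only: sat_Just) blast
    qed (simp only: sat_Just, simp)
    ultimately show ?case by blast
  qed
  have "fitting_model CS (UNIV :: label set) R Ev" by (fact model)
  moreover have "holds id \<phi>" if "\<phi> \<in># \<Gamma>" for \<phi>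
  proof -
    have "\<phi> \<in> G"
      using that b(1) unfolding G_def by (metis UN_I UNIV_I fst_conv)
    with truth show ?thesis
      by (cases \<phi>) (simp_all only: holds_atom, simp)
  qed
  moreover have "\<not> holds id \<phi>" if "\<phi> \<in># \<Delta>" for \<phi>
  proof -
    have "\<phi> \<in> D"
      using that b(1) unfolding D_def by (metis UN_I UNIV_I snd_conv)
    show ?thesis
    proof (cases \<phi>)
      case (Forces w A)
      with truth \<open>\<phi> \<in> D\<close> show ?thesis by simp
    next
      case (Rel w v)
      have "\<not> (Rel w v \<in> G \<and> Rel w v \<in> D)"
        by (rule disjoint) (simp_all add: right_done_atom init_Rel)
      with Rel \<open>\<phi> \<in> D\<close> show ?thesis by (simp only: holds_atom) blast
    next
      case (Evid w t A)
      have "\<not> (Evid w t A \<in> G \<and> Evid w t A \<in> D)"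
        by (rule disjoint) (simp_all add: right_done_atom init_Evid)
      with Evid \<open>\<phi> \<in> D\<close> show ?thesis by (simp only: holds_atom) blast
    qed
  qed
  ultimately show ?thesis
    by (intro that) auto
qed


section \<open>Codes of finite models\<close>

text \<open>All codes and labels occurring in an instance are bounded by its code \<open>x\<close>. A world is coded
  by a pair of a label (\<open>Suc x\<close> for worlds that interpret no label of the sequent) and a finite set
  of natural numbers that records the formulas true there (tag 0), the formulas false there (tag 1)
  and the evidence available there (tag 2). Truth and falsity are recorded separately, as in Hintikka
  sets, because a number that codes no formula need be neither.\<close>

definition cs_mem :: "nat \<Rightarrow> nat \<Rightarrow> bool" where
  "cs_mem x n \<longleftrightarrow> n \<in> set (list_decode (first x))"

definition left_mem :: "nat \<Rightarrow> nat \<Rightarrow> bool" where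
  "left_mem x n \<longleftrightarrow> n \<in> set (list_decode (first (second x)))"

definition right_mem :: "nat \<Rightarrow> nat \<Rightarrow> bool" where
  "right_mem x n \<longleftrightarrow> n \<in> set (list_decode (second (second x)))"

definition is_true :: "nat \<Rightarrow> nat \<Rightarrow> bool" where
  "is_true w a \<longleftrightarrow> pair 0 a \<in> set_decode (second w)"

definition is_false :: "nat \<Rightarrow> nat \<Rightarrow> bool" where
  "is_false w a \<longleftrightarrow> pair 1 a \<in> set_decode (second w)"

definition is_evid :: "nat \<Rightarrow> nat \<Rightarrow> nat \<Rightarrow> bool" where
  "is_evid w t a \<longleftrightarrow> pair 2 (pair t a) \<in> set_decode (second w)"

text \<open>A world with a label up to \<open>x\<close> is entered only along a relational atom on
  the left or from itself, so relational atoms on the right can stay false. Worlds labeled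
  \<open>Suc x\<close> are exempt. The second conjunct is that of the coarsest filtration.\<close>

definition acc :: "nat \<Rightarrow> nat \<Rightarrow> nat \<Rightarrow> bool" where
  "acc x w v \<longleftrightarrow>
     (first v = Suc x \<or> left_mem x (pair 1 (pair (first w) (first v))) \<or> w = v) \<and>
     (\<forall>t\<le>x. \<forall>a\<le>x. is_true w (pair 6 (pair t a)) \<longrightarrow> is_true v a)"

definition propositional_ok :: "nat \<Rightarrow> nat \<Rightarrow> bool" where
  "propositional_ok x w \<longleftrightarrow> \<not> is_true w (pair 1 0) \<and> (\<forall>a\<le>x.
     \<not> (is_true w a \<and> is_false w a) \<and>
     (is_true w (pair 2 a) \<longrightarrow> is_false w a) \<and>
     (is_false w (pair 2 a) \<longrightarrow> is_true w a) \<and>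
     (\<forall>b\<le>x.
       (is_true w (pair 3 (pair a b)) \<longrightarrow> is_true w a \<and> is_true w b) \<and>
       (is_false w (pair 3 (pair a b)) \<longrightarrow> is_false w a \<or> is_false w b) \<and>
       (is_true w (pair 4 (pair a b)) \<longrightarrow> is_true w a \<or> is_true w b) \<and>
       (is_false w (pair 4 (pair a b)) \<longrightarrow> is_false w a \<and> is_false w b) \<and>
       (is_true w (pair 5 (pair a b)) \<longrightarrow> is_false w a \<or> is_true w b) \<and>
       (is_false w (pair 5 (pair a b)) \<longrightarrow> is_true w a \<and> is_false w b)))"

text \<open>Without the guards on compound codes, evidence would be demanded for terms above
  \<open>x\<close>, which the worlds of the filtrated model do not record.\<close>

definition evidence_ok :: "nat \<Rightarrow> nat \<Rightarrow> bool" where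
  "evidence_ok x w \<longleftrightarrow>
     (\<forall>s\<le>x. \<forall>t\<le>x. \<forall>a\<le>x.
       (is_evid w t a \<and> pair 3 (pair s t) \<le> x \<longrightarrow> is_evid w (pair 3 (pair s t)) a) \<and>
       (is_evid w t a \<and> pair 3 (pair t s) \<le> x \<longrightarrow> is_evid w (pair 3 (pair t s)) a) \<and>
       (\<forall>b\<le>x. is_evid w s (pair 5 (pair a b)) \<and> is_evid w t a \<and> pair 2 (pair s t) \<le> x \<longrightarrow>
         is_evid w (pair 2 (pair s t)) b)) \<and>
     (\<forall>c\<le>x. \<forall>a\<le>x. cs_mem x (pair 6 (pair (pair 1 c) a)) \<longrightarrow> is_evid w (pair 1 c) a)"

definition sequent_ok :: "nat \<Rightarrow> nat \<Rightarrow> bool" where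
  "sequent_ok x w \<longleftrightarrow> (\<forall>a\<le>x.
     (left_mem x (pair 0 (pair (first w) a)) \<longrightarrow> is_true w a) \<and>
     (right_mem x (pair 0 (pair (first w) a)) \<longrightarrow> is_false w a) \<and>
     (\<forall>t\<le>x.
       (left_mem x (pair 2 (pair (first w) (pair t a))) \<longrightarrow> is_evid w t a) \<and>
       (right_mem x (pair 2 (pair (first w) (pair t a))) \<longrightarrow> \<not> is_evid w t a)))"

text \<open>2 is the largest tag, and \<open>pair x x\<close> bounds both a formula code and a pair
  of a term and a formula code.\<close>

definition element_bound :: "nat \<Rightarrow> nat" where
  "element_bound x = pair 2 (pair x x)"

definition world_bound :: "nat \<Rightarrow> nat" where
  "world_bound x = pair (Suc x) (2 ^ Suc (element_bound x))"

text \<open>A false \<open>Just t A\<close> needs a refuting successor only where evidence for it is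
  present. Reflexivity is a real condition on \<open>w\<close>: whatever is justified as true at
  \<open>w\<close> must be true there.\<close>

definition frame_ok :: "nat \<Rightarrow> nat \<Rightarrow> nat \<Rightarrow> bool" where
  "frame_ok x U w \<longleftrightarrow> acc x w w \<and>
     (\<forall>v\<le>world_bound x. v \<in> set_decode U \<and> left_mem x (pair 1 (pair (first w) (first v))) \<longrightarrow>
       acc x w v) \<and>
     (\<forall>t\<le>x. \<forall>a\<le>x.
       (is_true w (pair 6 (pair t a)) \<longrightarrow> is_evid w t a) \<and>
       (is_false w (pair 6 (pair t a)) \<and> is_evid w t a \<longrightarrow>
         (\<exists>v\<le>world_bound x. v \<in> set_decode U \<and> acc x w v \<and> is_false v a)))"

text \<open>Each label up to \<open>Suc x\<close> gets a world so that all labels can be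
  interpreted. As \<open>acc\<close> is reflexive, a relational atom on the right must not relate a
  label to itself.\<close>

definition countermodel_code :: "nat \<Rightarrow> nat \<Rightarrow> bool" where
  "countermodel_code x U \<longleftrightarrow>
     (\<forall>l\<le>Suc x. \<exists>w\<le>world_bound x. w \<in> set_decode U \<and> first w = l) \<and>
     (\<forall>w\<le>world_bound x. w \<in> set_decode U \<longrightarrow>
       propositional_ok x w \<and> evidence_ok x w \<and> sequent_ok x w \<and> frame_ok x U w) \<and>
     (\<forall>l\<le>x. \<forall>m\<le>x. right_mem x (pair 1 (pair l m)) \<longrightarrow>
       l \<noteq> m \<and> \<not> left_mem x (pair 1 (pair l m)))"

section \<open>Computability of the conditions on models\<close>

lemma computable_pred_cs_mem:
  "computable f \<Longrightarrow> computable g \<Longrightarrow> computable_pred (\<lambda>z. cs_mem (f z) (g z))"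
  unfolding cs_mem_def by (intro computable_pred_intros computable_intros)

lemma computable_pred_left_mem:
  "computable f \<Longrightarrow> computable g \<Longrightarrow> computable_pred (\<lambda>z. left_mem (f z) (g z))"
  unfolding left_mem_def by (intro computable_pred_intros computable_intros)

lemma computable_pred_right_mem:
  "computable f \<Longrightarrow> computable g \<Longrightarrow> computable_pred (\<lambda>z. right_mem (f z) (g z))"
  unfolding right_mem_def by (intro computable_pred_intros computable_intros)

lemma computable_pred_is_true:
  "computable f \<Longrightarrow> computable g \<Longrightarrow> computable_pred (\<lambda>z. is_true (f z) (g z))"
  unfolding is_true_def by (intro computable_pred_intros computable_intros)

lemma computable_pred_is_false:
  "computable f \<Longrightarrow> computable g \<Longrightarrow> computable_pred (\<lambda>z. is_false (f z) (g z))"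
  unfolding is_false_def by (intro computable_pred_intros computable_intros)

lemma computable_pred_is_evid:
  "computable f \<Longrightarrow> computable g \<Longrightarrow> computable h \<Longrightarrow> computable_pred (\<lambda>z. is_evid (f z) (g z) (h z))"
  unfolding is_evid_def by (intro computable_pred_intros computable_intros)

lemmas model_intros = computable_pred_cs_mem computable_pred_left_mem computable_pred_right_mem
  computable_pred_is_true computable_pred_is_false computable_pred_is_evid
  computable_pred_intros computable_intros

lemma computable_pred_acc:
  assumes "computable f" "computable g" "computable h"
  shows "computable_pred (\<lambda>z. acc (f z) (g z) (h z))"
proof -
  have "computable_pred (\<lambda>z. acc (first z) (first (second z)) (second (second z)))"
    unfolding acc_def by (intro model_intros)
  from computable_pred_comp[OF this, of "\<lambda>z. pair (f z) (pair (g z) (h z))"] show ?thesis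
    by (simp add: computable_pair assms)
qed

lemma computable_world_bound: "computable f \<Longrightarrow> computable (\<lambda>z. world_bound (f z))"
  unfolding world_bound_def element_bound_def by (intro computable_intros computable_power2)

lemma computable_pred_countermodel_code:
  "computable_pred (\<lambda>z. countermodel_code (second z) (first z))"
  unfolding countermodel_code_def propositional_ok_def evidence_ok_def sequent_ok_def frame_ok_def
  by (intro model_intros computable_pred_acc computable_world_bound)

section \<open>Bounds on codes\<close>

lemma pair_mono: "pair a b \<le> pair c d" if "a \<le> c" "b \<le> d"
  using that triangle_mono[of "a + b" "c + d"] by (simp add: prod_encode_def)

lemma set_encode_less: "S \<subseteq> {..n} \<Longrightarrow> set_encode S < 2 ^ Suc n"
proof -
  assume "S \<subseteq> {..n}"
  then have "set_encode S \<le> (\<Sum>i\<in>{0..<Suc n}. 2 ^ i)"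
    unfolding set_encode_def by (intro sum_mono2) auto
  also have "\<dots> < 2 ^ Suc n"
    unfolding sum_power2 by simp
  finally show ?thesis .
qed

lemma mem_le_list_encode: "n \<in> set ns \<Longrightarrow> n \<le> list_encode ns"
proof (induction ns)
  case (Cons m ns)
  then show ?case
    using le_prod_encode_1[of m "list_encode ns"] le_prod_encode_2[of "list_encode ns" m] by auto
qed simp

lemma first_le: "first z \<le> z" and second_le: "second z \<le> z"
  using le_prod_encode_1[of "first z" "second z"] le_prod_encode_2[of "second z" "first z"]
  by simp_all

text \<open>Hence the terms and formulas with codes up to \<open>x\<close> are closed under subterms
  and subformulas, as the set behind a filtration must be.\<close>

lemma pair_leD: "pair a b \<le> x \<Longrightarrow> a \<le> x \<and> b \<le> x"
  using le_prod_encode_1[of a b] le_prod_encode_2[of b a] by linarith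

lemma pair3_leD: "pair k (pair a b) \<le> x \<Longrightarrow> a \<le> x \<and> b \<le> x"
  using pair_leD[of k "pair a b" x] pair_leD[of a b x] by blast

lemma pair4_leD: "pair k (pair l (pair a b)) \<le> x \<Longrightarrow> l \<le> x \<and> a \<le> x \<and> b \<le> x"
  using pair3_leD[of k l "pair a b" x] pair_leD[of a b x] by blast

lemma left_mem_le: "left_mem x n \<Longrightarrow> n \<le> x"
  and right_mem_le: "right_mem x n \<Longrightarrow> n \<le> x"
  and cs_mem_le: "cs_mem x n \<Longrightarrow> n \<le> x"
proof -
  have *: "n \<le> c" if "n \<in> set (list_decode c)" for c
    using mem_le_list_encode[OF that] by simp
  show "left_mem x n \<Longrightarrow> n \<le> x"
    unfolding left_mem_def using *[of "first (second x)"] first_le[of "second x"] second_le[of x]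
    by linarith
  show "right_mem x n \<Longrightarrow> n \<le> x"
    unfolding right_mem_def using *[of "second (second x)"] second_le[of "second x"] second_le[of x]
    by linarith
  show "cs_mem x n \<Longrightarrow> n \<le> x"
    unfolding cs_mem_def using *[of "first x"] first_le[of x] by linarith
qed

lemma propositional_ok_unary:
  assumes "propositional_ok x w" "a \<le> x"
  shows "\<not> (is_true w a \<and> is_false w a)"
    "is_true w (pair 2 a) \<Longrightarrow> is_false w a"
    "is_false w (pair 2 a) \<Longrightarrow> is_true w a"
  using assms unfolding propositional_ok_def by blast+

lemma propositional_ok_binary:
  assumes "propositional_ok x w" "a \<le> x" "b \<le> x"
  shows "is_true w (pair 3 (pair a b)) \<Longrightarrow> is_true w a \<and> is_true w b"
    "is_false w (pair 3 (pair a b)) \<Longrightarrow> is_false w a \<or> is_false w b"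
    "is_true w (pair 4 (pair a b)) \<Longrightarrow> is_true w a \<or> is_true w b"
    "is_false w (pair 4 (pair a b)) \<Longrightarrow> is_false w a \<and> is_false w b"
    "is_true w (pair 5 (pair a b)) \<Longrightarrow> is_false w a \<or> is_true w b"
    "is_false w (pair 5 (pair a b)) \<Longrightarrow> is_true w a \<and> is_false w b"
  using assms unfolding propositional_ok_def by blast+

lemma evidence_okD:
  assumes "evidence_ok x w"
  shows "is_evid w t a \<Longrightarrow> a \<le> x \<Longrightarrow> pair 3 (pair s t) \<le> x \<Longrightarrow> is_evid w (pair 3 (pair s t)) a"
    "is_evid w t a \<Longrightarrow> a \<le> x \<Longrightarrow> pair 3 (pair t s) \<le> x \<Longrightarrow> is_evid w (pair 3 (pair t s)) a"
    "is_evid w s (pair 5 (pair a b)) \<Longrightarrow> is_evid w t a \<Longrightarrow> a \<le> x \<Longrightarrow> b \<le> x \<Longrightarrow>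
      pair 2 (pair s t) \<le> x \<Longrightarrow> is_evid w (pair 2 (pair s t)) b"
    "cs_mem x (pair 6 (pair (pair 1 c) a)) \<Longrightarrow> is_evid w (pair 1 c) a"
proof -
  show "is_evid w (pair 3 (pair s t)) a" if "is_evid w t a" "a \<le> x" "pair 3 (pair s t) \<le> x"
    using assms that pair3_leD[OF that(3)] unfolding evidence_ok_def by blast
  show "is_evid w (pair 3 (pair t s)) a" if "is_evid w t a" "a \<le> x" "pair 3 (pair t s) \<le> x"
    using assms that pair3_leD[OF that(3)] unfolding evidence_ok_def by blast
  show "is_evid w (pair 2 (pair s t)) b" if "is_evid w s (pair 5 (pair a b))" "is_evid w t a"
    "a \<le> x" "b \<le> x" "pair 2 (pair s t) \<le> x"
    using assms that pair3_leD[OF that(5)] unfolding evidence_ok_def by blast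
  show "is_evid w (pair 1 c) a" if "cs_mem x (pair 6 (pair (pair 1 c) a))"
  proof -
    have "pair 1 c \<le> x" "a \<le> x"
      using pair3_leD[OF cs_mem_le[OF that]] by simp_all
    then show ?thesis
      using assms that pair_leD[of 1 c x] unfolding evidence_ok_def by blast
  qed
qed

lemma left_mem_instance:
  "left_mem (instance_code (CS, \<Gamma>, \<Delta>)) n \<longleftrightarrow> (\<exists>\<phi>\<in>#\<Gamma>. n = lfm_code \<phi>)"
  by (auto simp: left_mem_def mset_code_def simp flip: set_mset_mset)

lemma right_mem_instance:
  "right_mem (instance_code (CS, \<Gamma>, \<Delta>)) n \<longleftrightarrow> (\<exists>\<phi>\<in>#\<Delta>. n = lfm_code \<phi>)"
  by (auto simp: right_mem_def mset_code_def simp flip: set_mset_mset)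

lemma cs_mem_instance:
  "finite CS \<Longrightarrow> cs_mem (instance_code (CS, \<Gamma>, \<Delta>)) n \<longleftrightarrow> n \<in> fm_code ` CS"
  by (simp add: cs_mem_def cs_code_def)

text \<open>\<open>evidence_ok\<close> ranges over all numbers, so closure must be checked also when
  a component codes no term; by this lemma the compound then codes no term either.\<close>

lemma Sum_code_in_range:
  "pair 3 (pair s t) \<in> range tm_code \<Longrightarrow> s \<in> range tm_code \<and> t \<in> range tm_code"
proof (erule rangeE)
  fix r
  show "pair 3 (pair s t) = tm_code r \<Longrightarrow> s \<in> range tm_code \<and> t \<in> range tm_code"
    by (cases r) auto
qed

lemma App_code_in_range:
  "pair 2 (pair s t) \<in> range tm_code \<Longrightarrow> s \<in> range tm_code \<and> t \<in> range tm_code"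
proof (erule rangeE)
  fix r
  show "pair 2 (pair s t) = tm_code r \<Longrightarrow> s \<in> range tm_code \<and> t \<in> range tm_code"
    by (cases r) auto
qed

lemma lfm_code_eq:
  "pair 0 (pair w a) = lfm_code \<phi> \<longleftrightarrow> (\<exists>A. \<phi> = Forces w A \<and> a = fm_code A)"
  "pair 1 (pair w v) = lfm_code \<phi> \<longleftrightarrow> \<phi> = Rel w v"
  "pair 2 (pair w (pair t' a)) = lfm_code \<phi> \<longleftrightarrow>
    (\<exists>t A. \<phi> = Evid w t A \<and> t' = tm_code t \<and> a = fm_code A)"
  by (cases \<phi>; auto)+

lemma fm_code_eq:
  "pair 1 0 = fm_code C \<longleftrightarrow> C = Bot"
  "pair 2 a = fm_code C \<longleftrightarrow> (\<exists>A. C = Neg A \<and> a = fm_code A)"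
  "pair 3 (pair a b) = fm_code C \<longleftrightarrow> (\<exists>A B. C = And A B \<and> a = fm_code A \<and> b = fm_code B)"
  "pair 4 (pair a b) = fm_code C \<longleftrightarrow> (\<exists>A B. C = Or A B \<and> a = fm_code A \<and> b = fm_code B)"
  "pair 5 (pair a b) = fm_code C \<longleftrightarrow> (\<exists>A B. C = Imp A B \<and> a = fm_code A \<and> b = fm_code B)"
  "pair 6 (pair t' a) = fm_code C \<longleftrightarrow> (\<exists>t A. C = Just t A \<and> t' = tm_code t \<and> a = fm_code A)"
  by (cases C; auto)+

section \<open>From codes to Fitting models\<close>

lemma countermodel_code_imp_underivable:
  assumes fin: "finite CS" and x: "x = instance_code (CS, \<Gamma>, \<Delta>)" and U: "countermodel_code x U"
  shows "\<not> G3JT CS \<Gamma> \<Delta>"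
proof
  assume deriv: "G3JT CS \<Gamma> \<Delta>"
  define W where "W = {w. w \<le> world_bound x \<and> w \<in> set_decode U}"
  \<comment> \<open>Terms above \<open>x\<close> have every formula as evidence. Smaller ones have
    only formulas with codes up to \<open>x\<close>, which survives application because the code of
    \<open>B\<close> is below that of \<open>Imp A B\<close>.\<close>
  define Ev where "Ev w t A \<longleftrightarrow>
    (tm_code t \<le> x \<longrightarrow> fm_code A \<le> x \<and> is_evid w (tm_code t) (fm_code A))" for w t A
  define V where "V w p \<longleftrightarrow> is_true w (pair 0 p)" for w p
  have ok: "propositional_ok x w" "evidence_ok x w" "sequent_ok x w" "frame_ok x U w" if "w \<in> W" for w
    using U that by (auto simp: countermodel_code_def W_def)
  have model: "fitting_model CS W (acc x) Ev"
  proof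
    show "acc x w w" if "w \<in> W" for w
      using ok(4)[OF that] by (simp add: frame_ok_def)
    show "Ev w (Sum s t) A \<and> Ev w (Sum t s) A" if "w \<in> W" "Ev w t A" for w s t A
    proof -
      have "Ev w (Sum s t) A"
        using evidence_okD(1)[OF ok(2)[OF that(1)], of "tm_code t" "fm_code A" "tm_code s"] that(2)
          pair3_leD[of 3 "tm_code s" "tm_code t" x]
        by (auto simp: Ev_def)
      moreover have "Ev w (Sum t s) A"
        using evidence_okD(2)[OF ok(2)[OF that(1)], of "tm_code t" "fm_code A" "tm_code s"] that(2)
          pair3_leD[of 3 "tm_code t" "tm_code s" x]
        by (auto simp: Ev_def)
      ultimately show ?thesis ..
    qed
    show "Ev w (App s t) B" if "w \<in> W" "Ev w s (Imp A B)" "Ev w t A" for w s t A B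
      unfolding Ev_def
    proof
      assume "tm_code (App s t) \<le> x"
      then have le: "pair 2 (pair (tm_code s) (tm_code t)) \<le> x"
        by simp
      then have "tm_code s \<le> x" "tm_code t \<le> x"
        using pair3_leD by blast+
      then have ev: "pair 5 (pair (fm_code A) (fm_code B)) \<le> x"
        "is_evid w (tm_code s) (pair 5 (pair (fm_code A) (fm_code B)))"
        "is_evid w (tm_code t) (fm_code A)"
        using that(2,3) by (simp_all add: Ev_def)
      then have "fm_code A \<le> x" "fm_code B \<le> x"
        using pair3_leD by blast+
      then show "fm_code B \<le> x \<and> is_evid w (tm_code (App s t)) (fm_code B)"
        using evidence_okD(3)[OF ok(2)[OF that(1)] ev(2,3) _ _ le] by simp
    qed
    show "Ev w (JConst c) F" if "w \<in> W" "Just (JConst c) F \<in> CS" for w c F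
    proof -
      have mem: "cs_mem x (pair 6 (pair (pair 1 c) (fm_code F)))"
        unfolding x cs_mem_instance[OF fin] using imageI[OF that(2), of fm_code] by simp
      then have "pair 1 c \<le> x" "fm_code F \<le> x"
        using pair3_leD[OF cs_mem_le[OF mem]] by simp_all
      then show ?thesis
        using evidence_okD(4)[OF ok(2)[OF that(1)] mem] by (simp add: Ev_def)
    qed
  qed
  interpret fitting_model CS W "acc x" Ev V
    by (fact model)
  \<comment> \<open>Only implications: a formula recorded as neither true nor false takes whatever
    value \<open>sat\<close> gives it.\<close>
  have truth: "(is_true w (fm_code A) \<longrightarrow> sat A w) \<and> (is_false w (fm_code A) \<longrightarrow> \<not> sat A w)"
    if "w \<in> W" "fm_code A \<le> x" for A w
    using that
  proof (induction A arbitrary: w)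
    case (PVar p)
    have "\<not> (is_true w (pair 0 p) \<and> is_false w (pair 0 p))"
      using propositional_ok_unary(1)[OF ok(1)[OF PVar.prems(1)] PVar.prems(2)] by simp
    then show ?case
      by (simp only: sat.simps fm_code.simps, simp only: V_def) blast
  next
    case Bot
    then show ?case
      using ok(1)[of w] by (simp add: propositional_ok_def)
  next
    case (Neg A)
    have le: "fm_code A \<le> x"
      using Neg.prems(2) pair_leD[of 2 "fm_code A" x] by simp
    show ?case
      using Neg.IH[OF Neg.prems(1) le] propositional_ok_unary[OF ok(1)[OF Neg.prems(1)] le]
      by auto
  next
    case (And A B)
    have le: "fm_code A \<le> x" "fm_code B \<le> x"
      using And.prems(2) pair3_leD[of 3 "fm_code A" "fm_code B" x] by simp_all
    show ?case
      using And.IH(1)[OF And.prems(1) le(1)] And.IH(2)[OF And.prems(1) le(2)]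
        propositional_ok_binary[OF ok(1)[OF And.prems(1)] le]
      by auto
  next
    case (Or A B)
    have le: "fm_code A \<le> x" "fm_code B \<le> x"
      using Or.prems(2) pair3_leD[of 4 "fm_code A" "fm_code B" x] by simp_all
    show ?case
      using Or.IH(1)[OF Or.prems(1) le(1)] Or.IH(2)[OF Or.prems(1) le(2)]
        propositional_ok_binary[OF ok(1)[OF Or.prems(1)] le]
      by auto
  next
    case (Imp A B)
    have le: "fm_code A \<le> x" "fm_code B \<le> x"
      using Imp.prems(2) pair3_leD[of 5 "fm_code A" "fm_code B" x] by simp_all
    show ?case
      using Imp.IH(1)[OF Imp.prems(1) le(1)] Imp.IH(2)[OF Imp.prems(1) le(2)]
        propositional_ok_binary[OF ok(1)[OF Imp.prems(1)] le]
      by auto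
  next
    case (Just t A)
    have le: "tm_code t \<le> x" "fm_code A \<le> x"
      using Just.prems(2) pair3_leD[of 6 "tm_code t" "fm_code A" x] by simp_all
    have Ev: "Ev w t A \<longleftrightarrow> is_evid w (tm_code t) (fm_code A)"
      using le by (simp add: Ev_def)
    have fr: "(is_true w (fm_code (Just t A)) \<longrightarrow> Ev w t A) \<and>
        (is_false w (fm_code (Just t A)) \<and> Ev w t A \<longrightarrow>
          (\<exists>v\<in>W. acc x w v \<and> is_false v (fm_code A)))"
      using ok(4)[OF Just.prems(1)] le unfolding frame_ok_def Ev W_def fm_code.simps by blast
    have "is_true v (fm_code A)" if "acc x w v" "is_true w (fm_code (Just t A))" for v
      using that le unfolding acc_def fm_code.simps by blast
    then show ?case
      using fr Just.IH[OF _ le(2)] unfolding sat.simps by blast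
  qed
  \<comment> \<open>Labels above \<open>x\<close> do not occur in the sequent, but
    \<open>soundness\<close> wants every label interpreted in \<open>W\<close>; a world labeled
    \<open>Suc x\<close> will do.\<close>
  define I where "I l = (SOME w. w \<in> W \<and> first w = (if l \<le> x then l else Suc x))" for l
  have I: "I l \<in> W" "first (I l) = (if l \<le> x then l else Suc x)" for l
  proof -
    have "(if l \<le> x then l else Suc x) \<le> Suc x"
      by simp
    then have "\<exists>w. w \<in> W \<and> first w = (if l \<le> x then l else Suc x)"
      using U unfolding countermodel_code_def W_def by blast
    from someI_ex[OF this] show "I l \<in> W" "first (I l) = (if l \<le> x then l else Suc x)"
      unfolding I_def by blast+
  qed
  have left: "left_mem x (lfm_code \<phi>)" if "\<phi> \<in># \<Gamma>" for \<phi>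
    using that unfolding x left_mem_instance by blast
  have right: "right_mem x (lfm_code \<phi>)" if "\<phi> \<in># \<Delta>" for \<phi>
    using that unfolding x right_mem_instance by blast
  have "holds I \<phi>" if "\<phi> \<in># \<Gamma>" for \<phi>
  proof (cases \<phi>)
    case (Forces l A)
    then have mem: "left_mem x (pair 0 (pair l (fm_code A)))"
      using left[OF that] by simp
    then have "l \<le> x" "fm_code A \<le> x"
      using pair3_leD[OF left_mem_le[OF mem]] by simp_all
    then show ?thesis
      using Forces mem ok(3)[OF I(1)[of l]] truth[OF I(1)[of l]] I(2)[of l]
      by (simp add: sequent_ok_def)
  next
    case (Rel l m)
    then have mem: "left_mem x (pair 1 (pair l m))"
      using left[OF that] by simp
    then have "l \<le> x" "m \<le> x"
      using pair3_leD[OF left_mem_le[OF mem]] by simp_all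
    then have "acc x (I l) (I m)"
      using mem ok(4)[OF I(1)[of l]] I[of l] I[of m]
      by (simp add: frame_ok_def W_def)
    then show ?thesis
      using Rel by simp
  next
    case (Evid l t A)
    then have mem: "left_mem x (pair 2 (pair l (pair (tm_code t) (fm_code A))))"
      using left[OF that] by simp
    then have "l \<le> x" "tm_code t \<le> x" "fm_code A \<le> x"
      using pair4_leD[OF left_mem_le[OF mem]] by simp_all
    then show ?thesis
      using Evid mem ok(3)[OF I(1)[of l]] I(2)[of l]
      by (simp add: sequent_ok_def Ev_def)
  qed
  then obtain \<phi> where \<phi>: "\<phi> \<in># \<Delta>" "holds I \<phi>"
    using soundness[OF deriv, of I] I(1) by blast
  show False
  proof (cases \<phi>)
    case (Forces l A)
    then have mem: "right_mem x (pair 0 (pair l (fm_code A)))"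
      using right[OF \<phi>(1)] by simp
    then have "l \<le> x" "fm_code A \<le> x"
      using pair3_leD[OF right_mem_le[OF mem]] by simp_all
    then show ?thesis
      using Forces \<phi>(2) mem ok(3)[OF I(1)[of l]] truth[OF I(1)[of l]] I(2)[of l]
      by (simp add: sequent_ok_def)
  next
    case (Rel l m)
    then have mem: "right_mem x (pair 1 (pair l m))"
      using right[OF \<phi>(1)] by simp
    then have le: "l \<le> x" "m \<le> x"
      using pair3_leD[OF right_mem_le[OF mem]] by simp_all
    then have "l \<noteq> m" "\<not> left_mem x (pair 1 (pair l m))"
      using U mem unfolding countermodel_code_def by blast+
    moreover have "acc x (I l) (I m)"
      using \<phi>(2) Rel by simp
    \<comment> \<open>The two worlds carry different labels, both at most \<open>x\<close>, so of
      the three ways of being related in \<open>acc\<close> only the excluded relational atom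
      remains.\<close>
    ultimately show ?thesis
      using le I(2)[of l] I(2)[of m] unfolding acc_def by auto
  next
    case (Evid l t A)
    then have mem: "right_mem x (pair 2 (pair l (pair (tm_code t) (fm_code A))))"
      using right[OF \<phi>(1)] by simp
    then have "l \<le> x" "tm_code t \<le> x" "fm_code A \<le> x"
      using pair4_leD[OF right_mem_le[OF mem]] by simp_all
    then show ?thesis
      using Evid \<phi>(2) mem ok(3)[OF I(1)[of l]] I(2)[of l]
      by (simp add: sequent_ok_def Ev_def)
  qed
qed

section \<open>Filtration of a countermodel\<close>

lemma underivable_imp_countermodel_code:
  assumes fin: "finite CS" and x: "x = instance_code (CS, \<Gamma>, \<Delta>)" and "\<not> G3JT CS \<Gamma> \<Delta>"
  shows "\<exists>U\<le>2 ^ Suc (world_bound x). countermodel_code x U"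
proof -
  obtain R Ev V where model: "fitting_model CS (UNIV :: label set) R Ev"
    and left: "\<forall>\<phi>\<in>#\<Gamma>. fitting_model.holds UNIV R Ev V id \<phi>"
    and right: "\<forall>\<phi>\<in>#\<Delta>. \<not> fitting_model.holds UNIV R Ev V id \<phi>"
    using completeness[OF assms(3)] by blast
  interpret fitting_model CS "UNIV :: label set" R Ev V
    by (fact model)
  \<comment> \<open>Non-codes of terms get all evidence up to \<open>x\<close>.
    \<open>evidence_ok\<close> forces this on some of them, such as a sum in which only one summand
    is a code.\<close>
  define evid where "evid u t a \<longleftrightarrow> t \<le> x \<and> a \<le> x \<and>
    (t \<in> range tm_code \<longrightarrow> (\<exists>s A. t = tm_code s \<and> a = fm_code A \<and> Ev u s A))" for u t a
  define T where "T u = {pair 0 (fm_code A) |A. fm_code A \<le> x \<and> sat A u} \<union>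
    {pair 1 (fm_code A) |A. fm_code A \<le> x \<and> \<not> sat A u} \<union> {pair 2 (pair t a) |t a. evid u t a}" for u
  define world where "world l u = pair l (set_encode (T u))" for l u
  have T_bound: "T u \<subseteq> {..element_bound x}" for u
  proof -
    have "a \<le> pair x x" if "a \<le> x" for a
      using that le_prod_encode_1[of x x] by linarith
    then show ?thesis
      unfolding T_def element_bound_def evid_def by (auto intro!: pair_mono)
  qed
  then have "finite (T u)" for u
    using finite_subset by blast
  then have decode: "set_decode (second (world l u)) = T u" for l u
    by (simp add: world_def)
  have is_true: "is_true (world l u) a \<longleftrightarrow> (\<exists>A. a = fm_code A \<and> fm_code A \<le> x \<and> sat A u)"
    and is_false: "is_false (world l u) a \<longleftrightarrow> (\<exists>A. a = fm_code A \<and> fm_code A \<le> x \<and> \<not> sat A u)"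
    and is_evid: "is_evid (world l u) t a \<longleftrightarrow> evid u t a" for l u t a
    unfolding is_true_def is_false_def is_evid_def decode T_def by auto
  have first_world: "first (world l u) = l" for l u
    by (simp add: world_def)
  \<comment> \<open>A label up to \<open>x\<close> keeps one world, namely itself; in addition every
    world has a copy labeled \<open>Suc x\<close>. Infinitely many \<open>u\<close> yield only
    finitely many sets \<open>T u\<close>.\<close>
  define Ws where "Ws = {world l u |l u. (l \<le> x \<and> u = l) \<or> l = Suc x}"
  have world_bound: "Ws \<subseteq> {..world_bound x}"
  proof
    fix w
    assume "w \<in> Ws"
    then obtain l u where w: "w = world l u" and "(l \<le> x \<and> u = l) \<or> l = Suc x"
      unfolding Ws_def by blast
    then have l: "l \<le> Suc x"
      by auto
    have "set_encode (T u) \<le> 2 ^ Suc (element_bound x)"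
      by (rule less_imp_le, rule set_encode_less, rule T_bound)
    then show "w \<in> {..world_bound x}"
      unfolding w world_def world_bound_def atMost_iff by (rule pair_mono[OF l])
  qed
  define U where "U = set_encode Ws"
  have U: "set_decode U = Ws"
    unfolding U_def by (rule set_encode_inverse) (rule finite_subset[OF world_bound finite_atMost])
  have Ws_le: "w \<le> world_bound x" if "w \<in> Ws" for w
    using world_bound that by auto
  \<comment> \<open>The filtration condition follows from \<open>R u v\<close>: if
    \<open>Just t A\<close> holds at \<open>u\<close>, then \<open>A\<close> holds at
    \<open>v\<close>, and its code is smaller.\<close>
  have acc: "acc x (world l u) (world m v)"
    if "R u v" "m = Suc x \<or> left_mem x (pair 1 (pair l m)) \<or> world l u = world m v" for l u m v
    using that unfolding acc_def first_world is_true fm_code_eq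
    by (fastforce dest: pair_leD)
  have label_left: "l \<le> x" if "left_mem x (pair k (pair l a))" for k l a
    using pair3_leD[OF left_mem_le[OF that]] by simp
  have label_right: "l \<le> x" if "right_mem x (pair k (pair l a))" for k l a
    using pair3_leD[OF right_mem_le[OF that]] by simp
  have ok: "propositional_ok x w \<and> evidence_ok x w \<and> sequent_ok x w \<and> frame_ok x U w"
    if "w \<in> Ws" for w
  proof -
    obtain l u where w: "w = world l u" and lu: "(l \<le> x \<and> u = l) \<or> l = Suc x"
      using \<open>w \<in> Ws\<close> by (auto simp: Ws_def)
    have "propositional_ok x w"
      unfolding propositional_ok_def w is_true is_false fm_code_eq
      by (auto simp: fm_code_inject)
    moreover have "evidence_ok x w"
      unfolding evidence_ok_def w is_evid
    proof (intro conjI allI impI)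
      fix s t a
      assume h: "evid u t a \<and> pair 3 (pair s t) \<le> x"
      have "\<exists>r A. pair 3 (pair s t) = tm_code r \<and> a = fm_code A \<and> Ev u r A"
        if code: "pair 3 (pair s t) \<in> range tm_code"
      proof -
        obtain s' where s': "s = tm_code s'"
          using Sum_code_in_range[OF code] by blast
        have "t \<in> range tm_code"
          using Sum_code_in_range[OF code] by blast
        then obtain t' A where "t = tm_code t'" "a = fm_code A" "Ev u t' A"
          using h unfolding evid_def by blast
        then show ?thesis
          using Ev_Sum[of u t' A s'] s' by (intro exI[of _ "Sum s' t'"] exI[of _ A]) simp
      qed
      with h show "evid u (pair 3 (pair s t)) a"
        unfolding evid_def by blast
    next
      fix s t a
      assume h: "evid u t a \<and> pair 3 (pair t s) \<le> x"
      have "\<exists>r A. pair 3 (pair t s) = tm_code r \<and> a = fm_code A \<and> Ev u r A"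
        if code: "pair 3 (pair t s) \<in> range tm_code"
      proof -
        obtain s' where s': "s = tm_code s'"
          using Sum_code_in_range[OF code] by blast
        have "t \<in> range tm_code"
          using Sum_code_in_range[OF code] by blast
        then obtain t' A where "t = tm_code t'" "a = fm_code A" "Ev u t' A"
          using h unfolding evid_def by blast
        then show ?thesis
          using Ev_Sum[of u t' A s'] s' by (intro exI[of _ "Sum t' s'"] exI[of _ A]) simp
      qed
      with h show "evid u (pair 3 (pair t s)) a"
        unfolding evid_def by blast
    next
      fix s t a b
      assume b: "b \<le> x" and h: "evid u s (pair 5 (pair a b)) \<and> evid u t a \<and> pair 2 (pair s t) \<le> x"
      have "\<exists>r B. pair 2 (pair s t) = tm_code r \<and> b = fm_code B \<and> Ev u r B"
        if code: "pair 2 (pair s t) \<in> range tm_code"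
      proof -
        have st: "s \<in> range tm_code" "t \<in> range tm_code"
          using App_code_in_range[OF code] by blast+
        obtain s' C where s': "s = tm_code s'" "pair 5 (pair a b) = fm_code C" "Ev u s' C"
          using h st(1) unfolding evid_def by blast
        obtain t' A' where t': "t = tm_code t'" "a = fm_code A'" "Ev u t' A'"
          using h st(2) unfolding evid_def by blast
        obtain A B where C: "C = Imp A B" "a = fm_code A" "b = fm_code B"
          using s'(2) unfolding fm_code_eq by blast
        have "A' = A"
          using t'(2) C(2) fm_code_inject by simp
        with s' t' C have "Ev u (App s' t') B"
          using Ev_App[of u s' A B t'] by simp
        then show ?thesis
          using s' t' C by (intro exI[of _ "App s' t'"] exI[of _ B]) simp
      qed
      with b h show "evid u (pair 2 (pair s t)) b"
        unfolding evid_def by blast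
    next
      fix c a
      assume mem: "cs_mem x (pair 6 (pair (pair 1 c) a))"
      obtain F where F: "F \<in> CS" "pair 6 (pair (pair 1 c) a) = fm_code F"
        using mem unfolding x cs_mem_instance[OF fin] by blast
      obtain t A where tA: "F = Just t A" "pair 1 c = tm_code t" "a = fm_code A"
        using F(2) unfolding fm_code_eq by blast
      have "tm_code t = tm_code (JConst c)"
        using tA(2) by simp
      then have "t = JConst c"
        unfolding tm_code_inject .
      then have "Ev u t A"
        using Ev_CS[of u c A] F(1) tA(1) by simp
      then show "evid u (pair 1 c) a"
        using pair3_leD[OF cs_mem_le[OF mem]] tA unfolding evid_def by blast
    qed
    moreover have "sequent_ok x w"
      unfolding sequent_ok_def w is_true is_false is_evid first_world
    proof (intro allI impI conjI)
      fix a
      assume a: "a \<le> x"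
      {
        assume mem: "left_mem x (pair 0 (pair l a))"
        then obtain A where "Forces l A \<in># \<Gamma>" "a = fm_code A"
          unfolding x left_mem_instance lfm_code_eq by blast
        \<comment> \<open>The sequent mentions only labels up to \<open>x\<close>, so this world is
          no copy labeled \<open>Suc x\<close>.\<close>
        moreover have "u = l"
          using label_left[OF mem] lu by simp
        ultimately show "\<exists>A. a = fm_code A \<and> fm_code A \<le> x \<and> sat A u"
          using left a by fastforce
      }
      {
        assume mem: "right_mem x (pair 0 (pair l a))"
        then obtain A where "Forces l A \<in># \<Delta>" "a = fm_code A"
          unfolding x right_mem_instance lfm_code_eq by blast
        moreover have "u = l"
          using label_right[OF mem] lu by simp
        ultimately show "\<exists>A. a = fm_code A \<and> fm_code A \<le> x \<and> \<not> sat A u"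
          using right a by fastforce
      }
      fix t
      assume t: "t \<le> x"
      {
        assume mem: "left_mem x (pair 2 (pair l (pair t a)))"
        then obtain t' A where "Evid l t' A \<in># \<Gamma>" "t = tm_code t'" "a = fm_code A"
          unfolding x left_mem_instance lfm_code_eq by blast
        moreover have "u = l"
          using label_left[OF mem] lu by simp
        ultimately show "evid u t a"
          using left a t unfolding evid_def by fastforce
      }
      {
        assume mem: "right_mem x (pair 2 (pair l (pair t a)))"
        then obtain t' A where tA: "Evid l t' A \<in># \<Delta>" "t = tm_code t'" "a = fm_code A"
          unfolding x right_mem_instance lfm_code_eq by blast
        have "u = l"
          using label_right[OF mem] lu by simp
        then have "\<not> Ev u t' A"
          using right tA(1) by fastforce
        then show "\<not> evid u t a"
          using tA(2,3) unfolding evid_def by (auto simp: tm_code_inject fm_code_inject)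
      }
    qed
    moreover have "frame_ok x U w"
      unfolding frame_ok_def U
    proof (intro allI impI conjI)
      show "acc x w w"
        unfolding w by (rule acc) (use R_refl in auto)
    next
      fix v
      assume v: "v \<in> Ws \<and> left_mem x (pair 1 (pair (first w) (first v)))"
      then obtain m v' where v': "v = world m v'" "(m \<le> x \<and> v' = m) \<or> m = Suc x"
        unfolding Ws_def by blast
      have mem: "left_mem x (pair 1 (pair l m))"
        using v unfolding v'(1) w first_world by blast
      then have "l \<le> x" "m \<le> x"
        using pair3_leD[OF left_mem_le[OF mem]] by simp_all
      then have "u = l" "v' = m"
        using lu v'(2) by auto
      moreover have "Rel l m \<in># \<Gamma>"
        using mem unfolding x left_mem_instance lfm_code_eq by blast
      then have "R l m"
        using left by fastforce
      ultimately show "acc x w v"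
        unfolding w v'(1) using mem by (intro acc) auto
    next
      fix t a
      assume a: "t \<le> x" "a \<le> x"
      {
        assume "is_true w (pair 6 (pair t a))"
        then obtain t' A where tA: "t = tm_code t'" "a = fm_code A" "sat (Just t' A) u"
          unfolding w is_true fm_code_eq by blast
        then have "Ev u t' A"
          by simp
        with tA(1,2) a show "is_evid w t a"
          unfolding w is_evid evid_def by blast
      }
      {
        assume h: "is_false w (pair 6 (pair t a)) \<and> is_evid w t a"
        then obtain t' A where tA: "t = tm_code t'" "a = fm_code A" "\<not> sat (Just t' A) u"
          unfolding w is_false fm_code_eq by blast
        have "Ev u t' A"
          using h tA(1,2) unfolding w is_evid evid_def by (auto simp: tm_code_inject fm_code_inject)
        with tA(3) obtain v where v: "R u v" "\<not> sat A v"
          by auto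
        \<comment> \<open>Even if \<open>v\<close> is a label up to \<open>x\<close>, no relational
          atom on the left need lead to it; its copy labeled \<open>Suc x\<close> can be entered
          without one.\<close>
        have "world (Suc x) v \<in> Ws"
          unfolding Ws_def by blast
        moreover have "acc x w (world (Suc x) v)"
          unfolding w by (rule acc) (use v in auto)
        moreover have "is_false (world (Suc x) v) a"
          using v(2) tA(2) a(2) unfolding is_false by blast
        ultimately show "\<exists>v\<le>world_bound x. v \<in> Ws \<and> acc x w v \<and> is_false v a"
          using Ws_le by blast
      }
    qed
    ultimately show ?thesis by blast
  qed
  have "countermodel_code x U"
    unfolding countermodel_code_def U
  proof (intro conjI allI impI)
    fix l assume "l \<le> Suc x"
    then have "l \<le> x \<or> l = Suc x"
      by auto
    then have "world l l \<in> Ws"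
      unfolding Ws_def by blast
    then show "\<exists>w\<le>world_bound x. w \<in> Ws \<and> first w = l"
      using Ws_le first_world by blast
  next
    fix l m assume "right_mem x (pair 1 (pair l m))"
    then have "Rel l m \<in># \<Delta>"
      unfolding x right_mem_instance lfm_code_eq by blast
    then have "\<not> R l m"
      using right by fastforce
    then show "l \<noteq> m" "\<not> left_mem x (pair 1 (pair l m))"
      using left R_refl unfolding x left_mem_instance lfm_code_eq by fastforce+
  qed (use ok in blast)+
  moreover have "U \<le> 2 ^ Suc (world_bound x)"
    unfolding U_def using set_encode_less[OF world_bound] by simp
  ultimately show ?thesis by blast
qed

theorem theorem9p2:
  "decidable_on instance_code
     {(CS :: fm set, S :: sequent). finite CS \<and> constant_specification CS}
     (\<lambda>(CS, \<Gamma>, \<Delta>). G3JT CS \<Gamma> \<Delta>)"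
proof -
  \<comment> \<open>\<open>P\<close> is a predicate of all numbers; only its values at codes of
    instances are compared with derivability.\<close>
  define P where "P x \<longleftrightarrow> \<not> (\<exists>U\<le>2 ^ Suc (world_bound x). countermodel_code x U)" for x
  have "computable_pred P"
    unfolding P_def[abs_def]
    by (intro computable_pred_not computable_pred_ex computable_pred_countermodel_code
        computable_power2 computable_Suc computable_world_bound computable_id)
  then obtain f where f: "recursive 1 f" "\<And>xs. length xs = 1 \<Longrightarrow> f xs = of_bool (P (xs ! 0))"
    unfolding computable_pred_def computable_def rec_fun_def by auto
  have "P (instance_code (CS, \<Gamma>, \<Delta>)) \<longleftrightarrow> G3JT CS \<Gamma> \<Delta>" if "finite CS" for CS \<Gamma> \<Delta>
    unfolding P_def
    using countermodel_code_imp_underivable[OF that HOL.refl] underivable_imp_countermodel_code[OF that HOL.refl]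
    by blast
  with f show ?thesis
    unfolding decidable_on_def by (intro exI[of _ f]) auto
qed

end
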